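(* Let $\mathcal{L}=(n,\mathcal{M},\mathcal{C})$ be a simple linearization and let $\mathcal{T}\subseteq\mathcal{P}$ be a subset of its proper monomials. Then $\mathrm{proj}_{\mathcal{S}\cup\mathcal{T}}(P(\mathcal{L}))$ is an integral polytope if and only if the digraph $D(\mathcal{L})$ does not contain a subgraph $Z$ such that (a) the undirected graph $G(Z)$ is a cycle, and (b) $V(Z)\subseteq \mathrm{succ}(\mathcal{T})$. Moreover, if this projection is integral and $\mathcal{P}\subseteq\mathrm{succ}(\mathcal{T})$, then the inequality system (i)–(iii) defining $P(\mathcal{L})$ is totally dual integral.
   Context: Fix a positive integer $n$, $[n]=\{1,\dots,n\}$. A monomial is a nonempty subset $m\subseteq[n]$; $\mathcal{S}=\{\{i\}: i\in[n]\}$ are the singleton monomials. A linearization is a triple $\mathcal{L}=(n,\mathcal{M},\mathcal{C})$, where $\mathcal{M}$ is a set of monomials with $\mathcal{S}\subseteq\mathcal{M}$, and $\mathcal{C}$ is a set of AND-constraints; each AND-constraint is a set $c=\{m_1,\dots,m_k\}\subseteq\mathcal{M}$ whose union $\bigcup c$ (its resultant) lies in $\mathcal{M}$. The proper monomials are $\mathcal{P}=\mathcal{M}\setminus\mathcal{S}$. Linearizations are assumed consistent: for each $m\in\mathcal{P}$ there is $c\in\mathcal{C}$ with $\bigcup c=m$ and $|m'|<|m|$ for all $m'\in c$. $\mathcal{L}$ is simple if each proper monomial is the resultant of exactly one AND-constraint and $|\mathcal{C}|=|\mathcal{P}|$. The relaxation $P(\mathcal{L})\subseteq\mathbb{R}^{\mathcal{M}}$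 is the set of $y$ satisfying (i) $0\le y_m\le 1$ for all $m\in\mathcal{M}$; (ii) $y_{\bigcup c}\le y_m$ for all $c\in\mathcal{C}$, $m\in c$; (iii) $\sum_{m\in c}y_m\le y_{\bigcup c}+|c|-1$ for all $c\in\mathcal{C}$. For simple $\mathcal{L}$, the digraph $D(\mathcal{L})$ has node set $\mathcal{M}$ and, for each $c\in\mathcal{C}$, an arc from $\bigcup c$ to each $m\in c$. For a digraph $D$, $G(D)$ denotes its underlying undirected graph and $V(D)$ its node set; cycles are simple cycles. For a node set $W$, $\mathrm{succ}(W)$ is the set of nodes reachable by directed paths from some node of $W$, including $W$ itself. $\mathrm{proj}_{\mathcal{M}'}$ denotes orthogonal projection onto the coordinates indexed by $\mathcal{M}'\subseteq\mathcal{M}$. A system $Ax\le b$ (rational data) is totally dual integral (TDI) if for every integral objective $w$ for which $\max\{w^\top x: Ax\le b\}$ is finite, the dual $\min\{b^\top u: A^\top u=w,u\ge0\}$ has an integral optimal solution. *)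

theory Defs
  imports Complex_Main
begin

text \<open>Monomials are nonempty subsets of [n] = {1..n}, represented as nat sets.
  Vectors in R^M are represented as functions nat set => real; for P(L) and its
  projections the coordinates outside the index set are fixed to 0.\<close>

definition singletons :: "nat \<Rightarrow> nat set set" where
  "singletons n = {{i} | i. i \<in> {1..n}}"

definition proper_monos :: "nat \<Rightarrow> nat set set \<Rightarrow> nat set set" where
  "proper_monos n M = M - singletons n"

definition linearization :: "nat \<Rightarrow> nat set set \<Rightarrow> nat set set set \<Rightarrow> bool" where
  "linearization n M C \<longleftrightarrow>
     0 < n \<and>
     (\<forall>m\<in>M. m \<noteq> {} \<and> m \<subseteq> {1..n}) \<and>
     singletons n \<subseteq> M \<and>
     (\<forall>c\<in>C. c \<subseteq> M \<and> \<Union>c \<in> M)"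

definition consistent :: "nat \<Rightarrow> nat set set \<Rightarrow> nat set set set \<Rightarrow> bool" where
  "consistent n M C \<longleftrightarrow>
     (\<forall>m\<in>proper_monos n M. \<exists>c\<in>C. \<Union>c = m \<and> (\<forall>m'\<in>c. card m' < card m))"

definition simple_lin :: "nat \<Rightarrow> nat set set \<Rightarrow> nat set set set \<Rightarrow> bool" where
  "simple_lin n M C \<longleftrightarrow>
     (\<forall>m\<in>proper_monos n M. \<exists>!c. c \<in> C \<and> \<Union>c = m) \<and>
     card C = card (proper_monos n M)"

definition relaxation :: "nat set set \<Rightarrow> nat set set set \<Rightarrow> (nat set \<Rightarrow> real) set" where
  "relaxation M C = {y.
     (\<forall>m. m \<notin> M \<longrightarrow> y m = 0) \<and>
     (\<forall>m\<in>M. 0 \<le> y m \<and> y m \<le> 1) \<and>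
     (\<forall>c\<in>C. \<forall>m\<in>c. y (\<Union>c) \<le> y m) \<and>
     (\<forall>c\<in>C. (\<Sum>m\<in>c. y m) \<le> y (\<Union>c) + real (card c) - 1)}"

definition proj :: "nat set set \<Rightarrow> (nat set \<Rightarrow> real) set \<Rightarrow> (nat set \<Rightarrow> real) set" where
  "proj K Q = (\<lambda>y. \<lambda>m. if m \<in> K then y m else 0) ` Q"

definition fconv_hull :: "(nat set \<Rightarrow> real) set \<Rightarrow> (nat set \<Rightarrow> real) set" where
  "fconv_hull V = {x. \<exists>u. (\<forall>v\<in>V. 0 \<le> u v) \<and> (\<Sum>v\<in>V. u v) = 1 \<and>
                        x = (\<lambda>m. \<Sum>v\<in>V. u v * v m)}"

definition is_extreme_point :: "(nat set \<Rightarrow> real) \<Rightarrow> (nat set \<Rightarrow> real) set \<Rightarrow> bool" where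
  "is_extreme_point x Q \<longleftrightarrow> x \<in> Q \<and>
     \<not> (\<exists>a\<in>Q. \<exists>b\<in>Q. a \<noteq> b \<and> (\<exists>t::real. 0 < t \<and> t < 1 \<and>
            x = (\<lambda>m. (1 - t) * a m + t * b m)))"

definition integral_polytope :: "(nat set \<Rightarrow> real) set \<Rightarrow> bool" where
  "integral_polytope Q \<longleftrightarrow>
     (\<exists>V. finite V \<and> Q = fconv_hull V) \<and>
     (\<forall>x. is_extreme_point x Q \<longrightarrow> (\<forall>m. x m \<in> \<int>))"

definition arcs_D :: "nat set set set \<Rightarrow> (nat set \<times> nat set) set" where
  "arcs_D C = {(\<Union>c, m) | c m. c \<in> C \<and> m \<in> c}"

definition succ :: "(nat set \<times> nat set) set \<Rightarrow> nat set set \<Rightarrow> nat set set" where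
  "succ A W = {v. \<exists>w\<in>W. (w, v) \<in> A\<^sup>*}"

definition is_cycle_graph :: "'a set \<Rightarrow> 'a set set \<Rightarrow> bool" where
  "is_cycle_graph V E \<longleftrightarrow>
     (\<exists>vs. 3 \<le> length vs \<and> distinct vs \<and> set vs = V \<and>
        E = {{vs ! i, vs ! ((i + 1) mod length vs)} | i. i < length vs})"

definition undirected :: "('a \<times> 'a) set \<Rightarrow> 'a set set" where
  "undirected A = {{u, v} | u v. (u, v) \<in> A}"

definition subdigraph :: "'a set \<Rightarrow> ('a \<times> 'a) set \<Rightarrow> 'a set \<Rightarrow> ('a \<times> 'a) set \<Rightarrow> bool" where
  "subdigraph VZ AZ V A \<longleftrightarrow> VZ \<subseteq> V \<and> AZ \<subseteq> A \<and> (\<forall>(u, v)\<in>AZ. u \<in> VZ \<and> v \<in> VZ)"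

definition TDI :: "'i set \<Rightarrow> 'k set \<Rightarrow> ('i \<Rightarrow> 'k \<Rightarrow> real) \<Rightarrow> ('i \<Rightarrow> real) \<Rightarrow> bool" where
  "TDI I K a b \<longleftrightarrow>
     (\<forall>w::'k \<Rightarrow> real. (\<forall>k\<in>K. w k \<in> \<int>) \<longrightarrow>
        (let feas = {x::'k \<Rightarrow> real. \<forall>i\<in>I. (\<Sum>k\<in>K. a i k * x k) \<le> b i} in
         let dfeas = {u::'i \<Rightarrow> real. (\<forall>i\<in>I. 0 \<le> u i) \<and>
                        (\<forall>k\<in>K. (\<Sum>i\<in>I. u i * a i k) = w k)} in
         (\<exists>x\<in>feas. \<forall>x'\<in>feas. (\<Sum>k\<in>K. w k * x' k) \<le> (\<Sum>k\<in>K. w k * x k)) \<longrightarrow>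
         (\<exists>u\<in>dfeas. (\<forall>i\<in>I. u i \<in> \<int>) \<and>
            (\<forall>u'\<in>dfeas. (\<Sum>i\<in>I. b i * u i) \<le> (\<Sum>i\<in>I. b i * u' i)))))"

datatype ineq = UpperB "nat set" | LowerB "nat set" | Dom "nat set set" "nat set"
  | AndC "nat set set"

definition ineq_index :: "nat set set \<Rightarrow> nat set set set \<Rightarrow> ineq set" where
  "ineq_index M C = UpperB ` M \<union> LowerB ` M \<union> {Dom c m | c m. c \<in> C \<and> m \<in> c} \<union> AndC ` C"

fun ineq_lhs :: "ineq \<Rightarrow> nat set \<Rightarrow> real" where
  "ineq_lhs (UpperB m) = (\<lambda>k. if k = m then 1 else 0)"
| "ineq_lhs (LowerB m) = (\<lambda>k. if k = m then -1 else 0)"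
| "ineq_lhs (Dom c m) = (\<lambda>k. (if k = \<Union>c then 1 else 0) - (if k = m then 1 else 0))"
| "ineq_lhs (AndC c) = (\<lambda>k. (if k \<in> c then 1 else 0) - (if k = \<Union>c then 1 else 0))"

fun ineq_rhs :: "ineq \<Rightarrow> real" where
  "ineq_rhs (UpperB m) = 1"
| "ineq_rhs (LowerB m) = 0"
| "ineq_rhs (Dom c m) = 0"
| "ineq_rhs (AndC c) = real (card c) - 1"

end

theory Submission
  imports Defs
begin

text \<open>
  If \<open>D\<close> restricted to \<open>succ T\<close> is a forest, the stars (a resultant together with the members of
  its AND-constraint) can be peeled off one at a time so that each meets the remaining ones in
  at most one node. A single star has an integral relaxation with an integral optimal dual, and two
  integral systems sharing a single 0/1 coordinate can be glued: convex decompositions are coupled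
  along the common coordinate, and dual solutions are added after shifting the weight of that
  coordinate. Proper monomials outside \<open>succ T\<close> impose no condition on the projection.

  Conversely, suppose two children of a node \<open>s\<close> below \<open>t \<in> T\<close> meet one class \<open>F\<close> of
  variables, where two variables are linked if they occur in a common member of \<open>T\<close> that does not
  reach \<open>s\<close>. The vector that is 0 on nodes reaching \<open>s\<close>, 1/2 on the other nodes meeting \<open>F\<close> and
  1 elsewhere lies in the relaxation; every integral point in a decomposition of its projection is
  constant on \<open>F\<close>, so the value at \<open>t\<close> would have to be 1/2 instead of 0. A cycle inside
  \<open>succ T\<close> always produces such a node \<open>s\<close>.
\<close>

section \<open>Cycles in finite graphs\<close>

text \<open>Gluing along one coordinate works because the law of a 0/1 coordinate is fixed by its
  mean: two mixtures with equal values at the common node can be coupled so that they agree there.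
  Two common nodes would carry a joint law that the relaxation does not determine, and a cycle
  exploits this. The constant 1/2 is the largest common value of two children that permits the value
  0 at \<open>s\<close>. Only single variables and members of \<open>T\<close> survive the
  projection, so equalities between variables must come from members of \<open>T\<close>; those that
  reach \<open>s\<close> have value 0 in the fractional vector and force no equality, hence their
  exclusion from the links. To find \<open>s\<close> in a cycle, the members of \<open>T\<close> are
  added one at a time. The argument with one common variable shows that below a single
  \<open>t\<close> every node has at most one parent. So a cycle avoiding the old part of the
  digraph is impossible at its smallest node. Otherwise a component of the cycle inside the old part
  is entered at two different nodes, and their lowest common ancestor below \<open>t\<close> is
  \<open>s\<close>: no old member reaches it, while the component links two of its children.\<close>

definition cyclic_walk :: "('a \<Rightarrow> 'a \<Rightarrow> bool) \<Rightarrow> 'a list \<Rightarrow> bool" where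
  "cyclic_walk adj vs \<longleftrightarrow> 3 \<le> length vs \<and> distinct vs \<and>
     (\<forall>i<length vs. adj (vs ! i) (vs ! ((i + 1) mod length vs)))"

text \<open>A longest path in \<open>U\<close> ending in \<open>a\<close> starts at a node other
  than \<open>a\<close>, since \<open>[b, a]\<close> is such a path. That node has a neighbour
  besides its successor, which by maximality lies on the path and closes a cycle. Exempting
  \<open>a\<close> from the degree condition makes the lemma applicable to a piece of a graph that
  is attached to the rest at one node only.\<close>

lemma cyclic_walk_if_dense:
  assumes fin: "finite U" and sym: "\<And>x y. adj x y \<Longrightarrow> adj y x" and irr: "\<And>x. \<not> adj x x"
    and a: "a \<in> U" "b \<in> U" "adj a b"
    and deg: "\<And>x. x \<in> U \<Longrightarrow> x \<noteq> a \<Longrightarrow> \<exists>y\<in>U. \<exists>z\<in>U. y \<noteq> z \<and> adj x y \<and> adj x z"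
  shows "\<exists>vs. cyclic_walk adj vs \<and> set vs \<subseteq> U"
proof -
  define path where
    "path p \<longleftrightarrow> p \<noteq> [] \<and> distinct p \<and> set p \<subseteq> U \<and> last p = a \<and> successively adj p" for p
  have ba: "path [b, a]"
    using a sym irr by (auto simp: path_def)
  have bound: "length p \<le> card U" if "path p" for p
    using that fin by (metis card_mono distinct_card path_def)
  obtain p where p: "path p" and max: "\<And>q. path q \<Longrightarrow> length q \<le> length p"
    using ex_has_greatest_nat[of path "[b, a]" length "card U + 1"] ba bound
    by (metis Suc_eq_plus1 le_imp_less_Suc)
  have "2 \<le> length p"
    using max[OF ba] by simp
  then obtain x x' ps where p_eq: "p = x # x' # ps"
    by (metis Suc_le_length_iff numeral_2_eq_2)
  have "x \<in> U" "x \<noteq> a"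
    using p by (auto simp: path_def p_eq split: if_splits)
  then obtain z where z: "z \<in> U" "z \<noteq> x'" "adj x z"
    using deg by metis
  have "z \<in> set p"
  proof (rule ccontr)
    assume "z \<notin> set p"
    then have "path (z # p)"
      using p z sym by (auto simp: path_def p_eq)
    from max[OF this] show False by simp
  qed
  then obtain j where j: "j < length p" "p ! j = z"
    by (metis in_set_conv_nth)
  \<comment> \<open>Position 0 is excluded by irreflexivity and position 1 by the choice of
    \<open>z\<close>, so the segment up to \<open>z\<close> has at least three nodes.\<close>
  have "j \<noteq> 0" "j \<noteq> 1"
    using j z irr by (auto simp: p_eq intro: ccontr)
  then have j2: "2 \<le> j" by simp
  define vs where "vs = take (j + 1) p"
  have len: "length vs = j + 1"
    using j by (simp add: vs_def)
  have "adj (vs ! i) (vs ! ((i + 1) mod length vs))" if "i < length vs" for i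
  proof (cases "i = j")
    case True
    then have "vs ! i = z"
      using j by (simp add: vs_def)
    moreover have "vs ! ((i + 1) mod length vs) = x"
      using True len by (simp add: vs_def p_eq)
    ultimately show ?thesis using z sym by simp
  next
    case False
    then have i: "i + 1 < j + 1"
      using that len by simp
    then have "adj (p ! i) (p ! Suc i)"
      using p j by (auto simp: path_def successively_conv_nth)
    then show ?thesis
      using i j len by (simp add: vs_def)
  qed
  moreover have "distinct vs" "set vs \<subseteq> U"
    using p set_take_subset[of "j + 1" p] by (auto simp: vs_def path_def)
  ultimately show ?thesis
    using j2 len unfolding cyclic_walk_def by (intro exI[of _ vs]) auto
qed

text \<open>Predecessor and successor along the cycle differ because the length is at least
  3.\<close>

lemma cyclic_walk_neighbours:
  assumes "cyclic_walk adj vs" and sym: "\<And>x y. adj x y \<Longrightarrow> adj y x" and "x \<in> set vs"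
  shows "\<exists>y\<in>set vs. \<exists>z\<in>set vs. y \<noteq> z \<and> adj x y \<and> adj x z"
proof -
  let ?l = "length vs"
  have l: "3 \<le> ?l" and d: "distinct vs"
    and step: "\<And>i. i < ?l \<Longrightarrow> adj (vs ! i) (vs ! ((i + 1) mod ?l))"
    using assms(1) by (auto simp: cyclic_walk_def)
  obtain i where i: "i < ?l" "vs ! i = x"
    using assms(3) by (metis in_set_conv_nth)
  define j where "j = (if i = 0 then ?l - 1 else i - 1)"
  define k where "k = (if i + 1 = ?l then 0 else i + 1)"
  have jk: "j < ?l" "k < ?l" "j \<noteq> k" "(j + 1) mod ?l = i" "(i + 1) mod ?l = k"
    using i l by (auto simp: j_def k_def)
  have "adj x (vs ! k)" "adj (vs ! j) x"
    using step[of i] step[of j] jk i by auto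
  moreover have "vs ! j \<noteq> vs ! k"
    using d jk by (simp add: nth_eq_iff_index_eq)
  ultimately show ?thesis
    using sym jk by (metis nth_mem)
qed

definition arc_adj :: "('a \<times> 'a) set \<Rightarrow> 'a \<Rightarrow> 'a \<Rightarrow> bool" where
  "arc_adj A x y \<longleftrightarrow> (x, y) \<in> A \<or> (y, x) \<in> A"

lemma arc_adj_sym: "arc_adj A x y \<Longrightarrow> arc_adj A y x"
  by (auto simp: arc_adj_def)

text \<open>Orientation is irrelevant for the cycle, so a list of nodes replaces the subgraph. In
  the converse direction its arc set is recovered as all arcs of \<open>A\<close> that lie over an
  edge of the cycle.\<close>

lemma cycle_subdigraph_iff:
  assumes A: "A \<subseteq> V \<times> V"
  shows "(\<exists>VZ AZ. subdigraph VZ AZ V A \<and> is_cycle_graph VZ (undirected AZ) \<and> VZ \<subseteq> W) \<longleftrightarrow>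
    (\<exists>vs. cyclic_walk (arc_adj A) vs \<and> set vs \<subseteq> W)"
proof
  assume "\<exists>VZ AZ. subdigraph VZ AZ V A \<and> is_cycle_graph VZ (undirected AZ) \<and> VZ \<subseteq> W"
  then obtain VZ AZ vs where Z: "subdigraph VZ AZ V A" "VZ \<subseteq> W"
    and vs: "3 \<le> length vs" "distinct vs" "set vs = VZ"
    and E: "undirected AZ = {{vs ! i, vs ! ((i + 1) mod length vs)} | i. i < length vs}"
    unfolding is_cycle_graph_def by blast
  have "arc_adj A (vs ! i) (vs ! ((i + 1) mod length vs))" if "i < length vs" for i
  proof -
    have "{vs ! i, vs ! ((i + 1) mod length vs)} \<in> undirected AZ"
      unfolding E using that by blast
    then show ?thesis
      using Z(1) by (auto simp: undirected_def arc_adj_def subdigraph_def doubleton_eq_iff)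
  qed
  then show "\<exists>vs. cyclic_walk (arc_adj A) vs \<and> set vs \<subseteq> W"
    using vs Z(2) unfolding cyclic_walk_def by blast
next
  assume "\<exists>vs. cyclic_walk (arc_adj A) vs \<and> set vs \<subseteq> W"
  then obtain vs where vs: "3 \<le> length vs" "distinct vs" "set vs \<subseteq> W"
    and step: "\<And>i. i < length vs \<Longrightarrow> arc_adj A (vs ! i) (vs ! ((i + 1) mod length vs))"
    unfolding cyclic_walk_def by blast
  define E where "E = {{vs ! i, vs ! ((i + 1) mod length vs)} | i. i < length vs}"
  define AZ where "AZ = {(u, v) \<in> A. {u, v} \<in> E}"
  have mem: "u \<in> set vs" "v \<in> set vs" if uv: "{u, v} \<in> E" for u v
  proof -
    obtain i where i: "i < length vs" "{u, v} = {vs ! i, vs ! ((i + 1) mod length vs)}"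
      using uv unfolding E_def by blast
    have "(i + 1) mod length vs < length vs"
      using i by (intro mod_less_divisor) auto
    then show "u \<in> set vs" "v \<in> set vs"
      using i by (auto simp: doubleton_eq_iff)
  qed
  have "undirected AZ = E"
  proof
    show "undirected AZ \<subseteq> E" by (auto simp: undirected_def AZ_def)
    show "E \<subseteq> undirected AZ"
    proof
      fix e assume e: "e \<in> E"
      then obtain i where i: "i < length vs" "e = {vs ! i, vs ! ((i + 1) mod length vs)}"
        unfolding E_def by blast
      let ?x = "vs ! i" and ?y = "vs ! ((i + 1) mod length vs)"
      have "(?x, ?y) \<in> AZ \<or> (?y, ?x) \<in> AZ"
        using step[OF i(1)] e i(2) by (auto simp: AZ_def arc_adj_def insert_commute)
      then show "e \<in> undirected AZ"
        unfolding undirected_def i(2) by (auto simp: insert_commute)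
    qed
  qed
  moreover have "set vs \<subseteq> V"
  proof
    fix x assume "x \<in> set vs"
    then obtain i where "i < length vs" "x = vs ! i" by (metis in_set_conv_nth)
    then show "x \<in> V" using step[of i] A by (auto simp: arc_adj_def)
  qed
  moreover have "\<forall>(u, v)\<in>AZ. u \<in> set vs \<and> v \<in> set vs" "AZ \<subseteq> A"
    using mem by (auto simp: AZ_def)
  ultimately have "subdigraph (set vs) AZ V A" "is_cycle_graph (set vs) (undirected AZ)"
    using vs unfolding subdigraph_def is_cycle_graph_def E_def by blast+
  then show "\<exists>VZ AZ. subdigraph VZ AZ V A \<and> is_cycle_graph VZ (undirected AZ) \<and> VZ \<subseteq> W"
    using vs(3) by blast
qed

text \<open>Without a leaf, the roots and the shared nodes form a graph in which every node has two
  neighbours, hence a cycle. A shared non-root is joined to two distinct roots; a root has two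
  shared kids, or one shared kid and a root above it.\<close>

lemma leaf_hyperedge:
  fixes root :: "'b \<Rightarrow> 'a" and kids :: "'b \<Rightarrow> 'a set" and rank :: "'a \<Rightarrow> nat"
  assumes B: "finite B" "B \<noteq> {}"
    and inj: "\<And>c c'. c \<in> B \<Longrightarrow> c' \<in> B \<Longrightarrow> root c = root c' \<Longrightarrow> c = c'"
    and fin: "\<And>c. c \<in> B \<Longrightarrow> finite (kids c)"
    and rank: "\<And>c m. c \<in> B \<Longrightarrow> m \<in> kids c \<Longrightarrow> rank m < rank (root c)"
    and W: "\<And>c. c \<in> B \<Longrightarrow> insert (root c) (kids c) \<subseteq> W"
    and adj: "\<And>c m. c \<in> B \<Longrightarrow> m \<in> kids c \<Longrightarrow> adj (root c) m"
      "\<And>c m. c \<in> B \<Longrightarrow> m \<in> kids c \<Longrightarrow> adj m (root c)"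
    and ac: "\<not> (\<exists>vs. cyclic_walk adj vs \<and> set vs \<subseteq> W)"
  shows "\<exists>c\<in>B. \<exists>r\<in>insert (root c) (kids c). \<forall>c'\<in>B. c' \<noteq> c \<longrightarrow>
    insert (root c) (kids c) \<inter> insert (root c') (kids c') \<subseteq> {r}"
proof (rule ccontr)
  assume no_leaf: "\<not> ?thesis"
  define R where "R c = insert (root c) (kids c)" for c
  have shared: "\<exists>c'\<in>B. c' \<noteq> c \<and> (\<exists>m\<in>R c \<inter> R c'. m \<noteq> r)" if "c \<in> B" "r \<in> R c" for c r
    using no_leaf that unfolding R_def[symmetric] by blast
  define adjB where "adjB x y \<longleftrightarrow> (\<exists>c\<in>B. (x = root c \<and> y \<in> kids c) \<or> (y = root c \<and> x \<in> kids c))" for x y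
  have sub: "adj x y" if "adjB x y" for x y
    using that adj unfolding adjB_def by blast
  \<comment> \<open>Kids that are neither shared nor roots have a single neighbour and are left
    out.\<close>
  define U where "U = root ` B \<union> {m. \<exists>c\<in>B. \<exists>c'\<in>B. c \<noteq> c' \<and> m \<in> R c \<inter> R c'}"
  have UW: "U \<subseteq> W" using W unfolding U_def R_def by blast
  have finU: "finite U"
    by (rule finite_subset[of _ "\<Union>(R ` B)"]) (use B(1) fin in \<open>auto simp: U_def R_def\<close>)
  have deg: "\<exists>y\<in>U. \<exists>z\<in>U. y \<noteq> z \<and> adjB x y \<and> adjB x z" if "x \<in> U" for x
  proof (cases "x \<in> root ` B")
    case False
    then obtain c c' where c: "c \<in> B" "c' \<in> B" "c \<noteq> c'" "x \<in> kids c" "x \<in> kids c'"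
      using \<open>x \<in> U\<close> unfolding U_def R_def by blast
    then have "root c \<noteq> root c'" using inj by blast
    moreover have "root c \<in> U" "root c' \<in> U" "adjB x (root c)" "adjB x (root c')"
      using c unfolding U_def adjB_def by blast+
    ultimately show ?thesis by blast
  next
    case True
    then obtain c where c: "c \<in> B" "x = root c" by blast
    \<comment> \<open>The absence of a leaf is used twice: excepting the root gives a shared kid,
      and excepting that kid gives another shared node, which may be the root itself.\<close>
    obtain c1 m1 where m1: "c1 \<in> B" "c1 \<noteq> c" "m1 \<in> R c \<inter> R c1" "m1 \<noteq> x"
      using shared[of c x] c unfolding R_def by blast
    have m1': "m1 \<in> U" "m1 \<in> kids c" "adjB x m1" "m1 \<in> R c"
      using m1 c unfolding U_def adjB_def R_def by blast+
    obtain c2 m2 where m2: "c2 \<in> B" "c2 \<noteq> c" "m2 \<in> R c \<inter> R c2" "m2 \<noteq> m1"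
      using shared[of c m1] c m1' by blast
    show ?thesis
    proof (cases "m2 = x")
      case False
      then have "m2 \<in> U" "adjB x m2"
        using m2 c unfolding U_def adjB_def R_def by blast+
      then show ?thesis using m1' m2(4) by blast
    next
      case True
      have "root c2 \<noteq> x" using m2 c inj by blast
      then have x: "x \<in> kids c2" using True m2(3) by (auto simp: R_def)
      have "rank m1 < rank x" "rank x < rank (root c2)"
        using rank c m1' x m2 by blast+
      then have "root c2 \<noteq> m1" by auto
      moreover have "root c2 \<in> U" "adjB x (root c2)"
        using m2(1) x unfolding U_def adjB_def by blast+
      ultimately show ?thesis using m1' by blast
    qed
  qed
  obtain a where "a \<in> U" using B(2) unfolding U_def by blast
  moreover from deg[OF this] obtain b where "b \<in> U" "adjB a b" by blast
  moreover have "adjB y x" if "adjB x y" for x y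
    using that unfolding adjB_def by blast
  moreover have "\<not> adjB x x" for x
    using rank unfolding adjB_def by blast
  ultimately obtain vs where "cyclic_walk adjB vs" "set vs \<subseteq> U"
    using cyclic_walk_if_dense[of U adjB a b] finU deg by blast
  then have "cyclic_walk adj vs" "set vs \<subseteq> W"
    using sub UW unfolding cyclic_walk_def by blast+
  then show False using ac by blast
qed

abbreviation star :: "'a set set \<Rightarrow> 'a set set" where
  "star c \<equiv> insert (\<Union>c) c"

lemma and_constraint_cong:
  "(\<And>m. m \<in> insert s c \<Longrightarrow> m \<in> Y \<longleftrightarrow> m \<in> X) \<Longrightarrow> (s \<in> Y \<longleftrightarrow> c \<subseteq> Y) \<longleftrightarrow> (s \<in> X \<longleftrightarrow> c \<subseteq> X)"
  by blast

section \<open>Mixtures of 0/1 vectors\<close>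

text \<open>Both laws give the event the same mass \<pi>; within the event and within its complement
  the two are made independent.\<close>

lemma finite_coupling:
  fixes p :: "'a \<Rightarrow> real" and q :: "'b \<Rightarrow> real"
  assumes fin: "finite A" "finite B"
    and p: "\<And>x. x \<in> A \<Longrightarrow> 0 \<le> p x" "sum p A = 1"
    and q: "\<And>z. z \<in> B \<Longrightarrow> 0 \<le> q z" "sum q B = 1"
    and eq: "sum p {x \<in> A. P x} = sum q {z \<in> B. Q z}"
  obtains r where "\<And>x z. x \<in> A \<Longrightarrow> z \<in> B \<Longrightarrow> 0 \<le> r x z"
    and "\<And>x z. r x z \<noteq> 0 \<Longrightarrow> P x \<longleftrightarrow> Q z"
    and "\<And>x. x \<in> A \<Longrightarrow> (\<Sum>z\<in>B. r x z) = p x"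
    and "\<And>z. z \<in> B \<Longrightarrow> (\<Sum>x\<in>A. r x z) = (q z :: real)"
proof -
  define \<pi> where "\<pi> = sum p {x \<in> A. P x}"
  \<comment> \<open>If a block has mass 0, division by zero yields 0. This is the right value, as
    all weights in that block vanish; \<open>p0\<close>, \<open>p1\<close>, \<open>q0\<close> and
    \<open>q1\<close> record it.\<close>
  define r where "r x z = (if P x \<and> Q z then p x * q z / \<pi>
    else if \<not> P x \<and> \<not> Q z then p x * q z / (1 - \<pi>) else 0)" for x z
  have pn: "sum p {x \<in> A. \<not> P x} = 1 - \<pi>"
    using sum.union_disjoint[of "{x \<in> A. P x}" "{x \<in> A. \<not> P x}" p] fin p(2)
    by (simp add: \<pi>_def Collect_disj_eq[symmetric] conj_disj_distribL[symmetric] disjoint_iff)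
  have qn: "sum q {z \<in> B. \<not> Q z} = 1 - \<pi>"
    using sum.union_disjoint[of "{x \<in> B. Q x}" "{x \<in> B. \<not> Q x}" q] fin q(2) eq
    by (simp add: \<pi>_def Collect_disj_eq[symmetric] conj_disj_distribL[symmetric] disjoint_iff)
  have \<pi>: "0 \<le> \<pi>" "0 \<le> 1 - \<pi>"
    unfolding pn[symmetric] using p by (auto simp: \<pi>_def intro: sum_nonneg)
  have p0: "p x = 0" if "x \<in> A" "P x" "\<pi> = 0" for x
    using that fin p sum_nonneg_0[of "{x \<in> A. P x}" p x] by (auto simp: \<pi>_def)
  have p1: "p x = 0" if "x \<in> A" "\<not> P x" "1 - \<pi> = 0" for x
    using that(1,2) fin p pn sum_nonneg_0[of "{x \<in> A. \<not> P x}" p x] unfolding that(3) by auto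
  have q0: "q x = 0" if "x \<in> B" "Q x" "\<pi> = 0" for x
    using that fin q sum_nonneg_0[of "{x \<in> B. Q x}" q x] by (auto simp: \<pi>_def eq)
  have q1: "q x = 0" if "x \<in> B" "\<not> Q x" "1 - \<pi> = 0" for x
    using that(1,2) fin q qn sum_nonneg_0[of "{x \<in> B. \<not> Q x}" q x] unfolding that(3) by auto
  show thesis
  proof
    show "0 \<le> r x z" if "x \<in> A" "z \<in> B" for x z
      using that p q \<pi> by (simp add: r_def)
    show "P x \<longleftrightarrow> Q z" if "r x z \<noteq> 0" for x z
      using that by (auto simp: r_def split: if_splits)
    show "(\<Sum>z\<in>B. r x z) = p x" if x: "x \<in> A" for x
    proof (cases "P x")
      case True
      then have "(\<Sum>z\<in>B. r x z) = (\<Sum>z\<in>{z \<in> B. Q z}. p x * q z / \<pi>)"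
        using fin by (auto simp: r_def sum.inter_filter intro!: sum.cong)
      also have "\<dots> = p x * \<pi> / \<pi>"
        by (simp add: \<pi>_def eq sum_distrib_left sum_divide_distrib)
      finally show ?thesis using p0[OF x True] by auto
    next
      case False
      then have "(\<Sum>z\<in>B. r x z) = (\<Sum>z\<in>{z \<in> B. \<not> Q z}. p x * q z / (1 - \<pi>))"
        using fin by (auto simp: r_def sum.inter_filter intro!: sum.cong)
      also have "\<dots> = p x * (1 - \<pi>) / (1 - \<pi>)"
        by (simp add: qn[symmetric] sum_distrib_left sum_divide_distrib)
      finally show ?thesis using p1[OF x False] by auto
    qed
    show "(\<Sum>x\<in>A. r x z) = q z" if z: "z \<in> B" for z
    proof (cases "Q z")
      case True
      then have "(\<Sum>x\<in>A. r x z) = (\<Sum>x\<in>{x \<in> A. P x}. p x * q z / \<pi>)"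
        using fin by (auto simp: r_def sum.inter_filter intro!: sum.cong)
      also have "\<dots> = \<pi> * q z / \<pi>"
        by (simp add: \<pi>_def sum_distrib_right sum_divide_distrib)
      finally show ?thesis using q0[OF z True] by auto
    next
      case False
      then have "(\<Sum>x\<in>A. r x z) = (\<Sum>x\<in>{x \<in> A. \<not> P x}. p x * q z / (1 - \<pi>))"
        using fin by (auto simp: r_def sum.inter_filter intro!: sum.cong)
      also have "\<dots> = (1 - \<pi>) * q z / (1 - \<pi>)"
        by (simp add: pn[symmetric] sum_distrib_right sum_divide_distrib)
      finally show ?thesis using q1[OF z False] by auto
    qed
  qed
qed


text \<open>A 0/1 vector is encoded as the set of coordinates with value 1.\<close>

definition mixes :: "'a set \<Rightarrow> 'a set set \<Rightarrow> ('a \<Rightarrow> real) \<Rightarrow> bool" where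
  "mixes K \<X> y \<longleftrightarrow> (\<exists>F u. finite F \<and> F \<subseteq> \<X> \<and> (\<forall>X\<in>F. 0 \<le> u X) \<and> sum u F = 1 \<and>
     (\<forall>m\<in>K. (\<Sum>X\<in>F. u X * of_bool (m \<in> X)) = y m))"

lemma mixesE:
  assumes "mixes K \<X> y"
  obtains F u where "finite F" "F \<subseteq> \<X>" "\<And>X. X \<in> F \<Longrightarrow> 0 \<le> u X" "sum u F = 1"
    "\<And>m. m \<in> K \<Longrightarrow> (\<Sum>X\<in>F. u X * of_bool (m \<in> X)) = y m"
  using assms unfolding mixes_def by blast

lemma mixes_subset: "mixes K \<X> y \<Longrightarrow> K' \<subseteq> K \<Longrightarrow> mixes K' \<X> y"
  unfolding mixes_def by (meson subsetD)

text \<open>Different indices may yield the same set, so their weights are collected. Membership in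
  \<open>\<X>\<close> is demanded only where the weight is nonzero, which lets couplings supported
  on compatible pairs be used.\<close>

lemma mixes_family:
  assumes fin: "finite I" and f: "\<And>i. i \<in> I \<Longrightarrow> u i \<noteq> 0 \<Longrightarrow> f i \<in> \<X>"
    and u: "\<And>i. i \<in> I \<Longrightarrow> 0 \<le> u i" "sum u I = 1"
    and y: "\<And>m. m \<in> K \<Longrightarrow> (\<Sum>i\<in>I. u i * of_bool (m \<in> f i)) = y m"
  shows "mixes K \<X> y"
proof -
  define J where "J = {i \<in> I. u i \<noteq> 0}"
  define v where "v X = sum u {i \<in> J. f i = X}" for X
  have J: "finite J" "J \<subseteq> I"
    using fin by (auto simp: J_def)
  have "sum v (f ` J) = sum u J"
    unfolding v_def by (rule sum.image_gen[OF J(1), symmetric])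
  also have "\<dots> = sum u I"
    using fin J by (intro sum.mono_neutral_left) (auto simp: J_def)
  finally have "sum v (f ` J) = 1" using u by simp
  moreover have "(\<Sum>X\<in>f ` J. v X * of_bool (m \<in> X)) = y m" if "m \<in> K" for m
  proof -
    have "(\<Sum>X\<in>f ` J. v X * of_bool (m \<in> X))
        = (\<Sum>X\<in>f ` J. \<Sum>i\<in>{i \<in> J. f i = X}. u i * of_bool (m \<in> f i))"
      by (simp add: v_def sum_distrib_right)
    also have "\<dots> = (\<Sum>i\<in>J. u i * of_bool (m \<in> f i))"
      by (rule sum.image_gen[OF J(1), symmetric])
    also have "\<dots> = (\<Sum>i\<in>I. u i * of_bool (m \<in> f i))"
      using fin J by (intro sum.mono_neutral_left) (auto simp: J_def)
    finally show ?thesis using y that by simp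
  qed
  moreover have "f ` J \<subseteq> \<X>" "\<forall>X\<in>f ` J. 0 \<le> v X"
    using f u by (auto simp: J_def v_def intro!: sum_nonneg)
  ultimately show ?thesis
    using J unfolding mixes_def by (intro exI[of _ "f ` J"] exI[of _ v]) auto
qed

text \<open>The two families are coupled so that \<open>P\<close> and \<open>Q\<close> agree. On
  compatible pairs each coordinate of the glued set depends on one side only, so its mean is read
  off from that marginal.\<close>

lemma mixes_glue_family:
  assumes fin: "finite A" "finite B"
    and p: "\<And>x. x \<in> A \<Longrightarrow> 0 \<le> p x" "sum p A = 1"
    and q: "\<And>z. z \<in> B \<Longrightarrow> 0 \<le> q z" "sum q B = 1"
    and eq: "sum p {x \<in> A. P x} = sum q {z \<in> B. Q z}"
    and f: "\<And>x z. x \<in> A \<Longrightarrow> z \<in> B \<Longrightarrow> P x \<longleftrightarrow> Q z \<Longrightarrow> f x z \<in> \<X>"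
    and y: "\<And>m. m \<in> K \<Longrightarrow>
        (\<exists>g. (\<forall>x z. (P x \<longleftrightarrow> Q z) \<longrightarrow> (m \<in> f x z \<longleftrightarrow> g x)) \<and> (\<Sum>x\<in>A. p x * of_bool (g x)) = y m) \<or>
        (\<exists>g. (\<forall>x z. (P x \<longleftrightarrow> Q z) \<longrightarrow> (m \<in> f x z \<longleftrightarrow> g z)) \<and> (\<Sum>z\<in>B. q z * of_bool (g z)) = y m)"
  shows "mixes K \<X> y"
proof -
  obtain r where r: "\<And>x z. x \<in> A \<Longrightarrow> z \<in> B \<Longrightarrow> 0 \<le> r x z"
    "\<And>x z. r x z \<noteq> 0 \<Longrightarrow> P x \<longleftrightarrow> Q z"
    "\<And>x. x \<in> A \<Longrightarrow> (\<Sum>z\<in>B. r x z) = p x"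
    "\<And>z. z \<in> B \<Longrightarrow> (\<Sum>x\<in>A. r x z) = q z"
    using finite_coupling[OF fin p q eq] by metis
  show ?thesis
  proof (rule mixes_family[where I = "A \<times> B" and u = "\<lambda>(x, z). r x z" and f = "\<lambda>(x, z). f x z"])
    show "finite (A \<times> B)" using fin by simp
    show "(case i of (x, z) \<Rightarrow> f x z) \<in> \<X>" if "i \<in> A \<times> B" "(case i of (x, z) \<Rightarrow> r x z) \<noteq> 0" for i
      using that f r(2) by auto
    show "0 \<le> (case i of (x, z) \<Rightarrow> r x z)" if "i \<in> A \<times> B" for i
      using that r(1) by auto
    show "(\<Sum>(x, z)\<in>A \<times> B. r x z) = 1"
      using p(2) r(3) by (simp add: sum.cartesian_product[symmetric])
    show "(\<Sum>i\<in>A \<times> B. (case i of (x, z) \<Rightarrow> r x z) * of_bool (m \<in> (case i of (x, z) \<Rightarrow> f x z))) = y m"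
      if "m \<in> K" for m
      using y[OF that]
    proof (elim disjE exE conjE)
      fix g assume g: "\<forall>x z. (P x \<longleftrightarrow> Q z) \<longrightarrow> (m \<in> f x z \<longleftrightarrow> g x)"
        and sm: "(\<Sum>x\<in>A. p x * of_bool (g x)) = y m"
      have "r x z * of_bool (m \<in> f x z) = r x z * of_bool (g x)" for x z
        using g r(2)[of x z] by (cases "r x z = 0") auto
      then have "(\<Sum>i\<in>A \<times> B. (case i of (x, z) \<Rightarrow> r x z) * of_bool (m \<in> (case i of (x, z) \<Rightarrow> f x z)))
          = (\<Sum>x\<in>A. \<Sum>z\<in>B. r x z * of_bool (g x))"
        by (simp only: case_prod_unfold sum.cartesian_product' fst_conv snd_conv)
      then show ?thesis
        using r(3) sm by (simp add: sum_distrib_right[symmetric])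
    next
      fix g assume g: "\<forall>x z. (P x \<longleftrightarrow> Q z) \<longrightarrow> (m \<in> f x z \<longleftrightarrow> g z)"
        and sm: "(\<Sum>z\<in>B. q z * of_bool (g z)) = y m"
      have "r x z * of_bool (m \<in> f x z) = r x z * of_bool (g z)" for x z
        using g r(2)[of x z] by (cases "r x z = 0") auto
      then have "(\<Sum>i\<in>A \<times> B. (case i of (x, z) \<Rightarrow> r x z) * of_bool (m \<in> (case i of (x, z) \<Rightarrow> f x z)))
          = (\<Sum>x\<in>A. \<Sum>z\<in>B. r x z * of_bool (g z))"
        by (simp only: case_prod_unfold sum.cartesian_product' fst_conv snd_conv)
      also have "\<dots> = (\<Sum>z\<in>B. \<Sum>x\<in>A. r x z * of_bool (g z))"
        by (rule sum.swap)
      finally show ?thesis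
        using r(4) sm by (simp add: sum_distrib_right[symmetric])
    qed
  qed
qed

lemma sum_of_bool_mult:
  "finite A \<Longrightarrow> (\<Sum>x\<in>A. (p x :: real) * of_bool (P x)) = sum p {x \<in> A. P x}"
  by (simp add: sum.inter_filter mult.commute of_bool_def if_distrib cong: if_cong)

text \<open>Induction on the children: the conjunction of all but one child is given the value \<open>t\<close>, and
  it is coupled with the remaining child, whose joint distribution with it is forced by
  \<open>y s\<close>.\<close>

lemma mixes_star:
  assumes "finite c" "c \<noteq> {}" "s \<notin> c"
    and "\<And>m. m \<in> c \<Longrightarrow> y s \<le> y m \<and> y m \<le> 1" "0 \<le> y s"
    and "1 - y s \<le> (\<Sum>m\<in>c. 1 - y m)"
  shows "mixes (insert s c) {X. s \<in> X \<longleftrightarrow> c \<subseteq> X} y"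
  using assms
proof (induction c arbitrary: y rule: finite_ne_induct)
  case (singleton m)
  have y: "y s = y m" "0 \<le> y m" "y m \<le> 1"
    using singleton(2)[of m] singleton(3,4) by auto
  show ?case
    by (rule mixes_family[where I = UNIV and u = "\<lambda>b. if b then y m else 1 - y m"
          and f = "\<lambda>b. if b then {s, m} else {}"]) (use y in \<open>auto simp: UNIV_bool\<close>)
next
  case (insert m c)
  \<comment> \<open>The least value that is at least \<open>y s\<close> and satisfies the last
    inequality for \<open>c\<close> alone. Being least, it keeps \<open>t + y m\<close> at most
    \<open>1 + y s\<close>, so that the weights \<open>q\<close> below are nonnegative.\<close>
  define t where "t = max (y s) (1 - (\<Sum>j\<in>c. 1 - y j))"
  obtain j where j: "j \<in> c" using insert.hyps by auto
  have tj: "t \<le> y j" if "j \<in> c" for j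
  proof -
    have "1 - y j \<le> (\<Sum>j\<in>c. 1 - y j)"
      using that insert.hyps insert.prems(2) by (intro member_le_sum) auto
    then show ?thesis using insert.prems(2)[of j] that by (auto simp: t_def)
  qed
  have ym: "y s \<le> y m" "y m \<le> 1" "0 \<le> y s"
    using insert.prems(2)[of m] insert.prems(3) by auto
  have t: "y s \<le> t" "t \<le> 1" "t + y m \<le> 1 + y s" "0 \<le> t"
    using ym insert.prems(4) insert.prems(2)[of j] tj[OF j] j insert.hyps by (auto simp: t_def)
  have sc: "(\<Sum>j\<in>c. 1 - (y(s := t)) j) = (\<Sum>j\<in>c. 1 - y j)"
    using insert.prems(1) by (intro sum.cong) auto
  have "mixes (insert s c) {X. s \<in> X \<longleftrightarrow> c \<subseteq> X} (y(s := t))"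
  proof (rule insert.IH)
    show "s \<notin> c" using insert.prems(1) by simp
    then show "(y(s := t)) s \<le> (y(s := t)) j \<and> (y(s := t)) j \<le> 1" if "j \<in> c" for j
      using that tj insert.prems(2)[of j] by auto
    show "0 \<le> (y(s := t)) s" "1 - (y(s := t)) s \<le> (\<Sum>j\<in>c. 1 - (y(s := t)) j)"
      unfolding sc using t by (auto simp: t_def)
  qed
  then obtain F u where F: "finite F" "F \<subseteq> {X. s \<in> X \<longleftrightarrow> c \<subseteq> X}" "\<And>X. X \<in> F \<Longrightarrow> 0 \<le> u X" "sum u F = 1"
    "\<And>j. j \<in> insert s c \<Longrightarrow> (\<Sum>X\<in>F. u X * of_bool (j \<in> X)) = (y(s := t)) j"
    by (rule mixesE) blast
  have ne: "s \<noteq> m" "s \<notin> c" "m \<notin> c" using insert.prems(1) insert.hyps by auto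
  \<comment> \<open>Law of the pair (all of \<open>c\<close>, \<open>m\<close>) with marginals
    \<open>t\<close> and \<open>y m\<close> and mass \<open>y s\<close> on both.\<close>
  define q where "q = (\<lambda>(a, b). if a then (if b then y s else t - y s)
     else (if b then y m - y s else 1 + y s - t - y m))"
  have B: "(UNIV :: (bool \<times> bool) set) = {(True, True), (True, False), (False, True), (False, False)}"
    by auto
  have BT: "{z :: bool \<times> bool. fst z} = {(True, True), (True, False)}"
    by auto
  \<comment> \<open>In the mixture from the induction hypothesis the coordinate \<open>s\<close>
    stands for the conjunction of \<open>c\<close>, with value \<open>t\<close>. It is overwritten
    here by the conjunction that includes \<open>m\<close>.\<close>
  define f where "f X z = (X - {s, m}) \<union> {k. k = m \<and> snd z} \<union> {k. k = s \<and> fst z \<and> snd z}"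
    for X and z :: "bool \<times> bool"
  have f: "s \<in> f X z \<longleftrightarrow> fst z \<and> snd z" "m \<in> f X z \<longleftrightarrow> snd z" for X z
    using ne by (auto simp: f_def)
  have fc: "k \<in> f X z \<longleftrightarrow> k \<in> X" if "k \<in> c" for k X z
    using ne that by (auto simp: f_def)
  show ?case
  proof (rule mixes_glue_family[where A = F and B = "UNIV :: (bool \<times> bool) set" and p = u and q = q
        and P = "\<lambda>X. s \<in> X" and Q = fst and f = f])
    show "0 \<le> q z" for z
      using t ym by (cases z) (simp add: q_def)
    show "sum q UNIV = 1"
      unfolding B by (simp add: q_def)
    show "sum u {X \<in> F. s \<in> X} = sum q {z \<in> UNIV. fst z}"
      using F(5)[of s] by (simp only: sum_of_bool_mult[OF F(1)]) (simp add: BT q_def)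
    show "f X z \<in> {X. s \<in> X \<longleftrightarrow> insert m c \<subseteq> X}" if "X \<in> F" "s \<in> X \<longleftrightarrow> fst z" for X z
    proof -
      have "s \<in> X \<longleftrightarrow> c \<subseteq> X" using that F(2) by auto
      moreover have "c \<subseteq> f X z \<longleftrightarrow> c \<subseteq> X" using fc by blast
      ultimately show ?thesis using that(2) by (simp add: f) blast
    qed
    fix k assume "k \<in> insert s (insert m c)"
    then consider "k = s" | "k = m" | "k \<in> c" by blast
    then show "(\<exists>g. (\<forall>x z. (s \<in> x \<longleftrightarrow> fst z) \<longrightarrow> (k \<in> f x z \<longleftrightarrow> g x)) \<and> (\<Sum>x\<in>F. u x * of_bool (g x)) = y k) \<or>
        (\<exists>g. (\<forall>x z. (s \<in> x \<longleftrightarrow> fst z) \<longrightarrow> (k \<in> f x z \<longleftrightarrow> g z)) \<and> (\<Sum>z\<in>UNIV. q z * of_bool (g z)) = y k)"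
    proof cases
      case 1
      have "(\<Sum>z\<in>UNIV. q z * of_bool (fst z \<and> snd z)) = y s"
        unfolding B by (simp add: q_def)
      then show ?thesis
        unfolding 1 f by (intro disjI2 exI[of _ "\<lambda>z. fst z \<and> snd z"]) simp
    next
      case 2
      have "(\<Sum>z\<in>UNIV. q z * of_bool (snd z)) = y m"
        unfolding B by (simp add: q_def)
      then show ?thesis
        unfolding 2 f by (intro disjI2 exI[of _ snd]) simp
    next
      case 3
      have "(\<Sum>X\<in>F. u X * of_bool (k \<in> X)) = y k"
        using F(5)[of k] 3 ne by auto
      then show ?thesis
        unfolding fc[OF 3] by (intro disjI1 exI[of _ "\<lambda>X. k \<in> X"]) simp
    qed
  qed (use F(1-4) in auto)
qed

text \<open>The event is membership of \<open>r\<close>, which has weight \<open>y r\<close> in both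
  mixtures. Coordinates in \<open>K\<^sub>1\<close> come from \<open>X\<close> and all others from
  \<open>Z\<close>; the two agree on the overlap.\<close>

lemma mixes_glue:
  assumes "mixes K\<^sub>1 \<X>\<^sub>1 y" "mixes K\<^sub>2 \<X>\<^sub>2 y" "r \<in> K\<^sub>1" "K\<^sub>1 \<inter> K\<^sub>2 = {r}"
    and glue: "\<And>X Z. X \<in> \<X>\<^sub>1 \<Longrightarrow> Z \<in> \<X>\<^sub>2 \<Longrightarrow> r \<in> X \<longleftrightarrow> r \<in> Z \<Longrightarrow> (X \<inter> K\<^sub>1) \<union> (Z - K\<^sub>1) \<in> \<X>"
  shows "mixes (K\<^sub>1 \<union> K\<^sub>2) \<X> y"
proof -
  obtain F u where F: "finite F" "F \<subseteq> \<X>\<^sub>1" "\<And>X. X \<in> F \<Longrightarrow> 0 \<le> u X" "sum u F = 1"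
    "\<And>m. m \<in> K\<^sub>1 \<Longrightarrow> (\<Sum>X\<in>F. u X * of_bool (m \<in> X)) = y m"
    using assms(1) by (rule mixesE) blast
  obtain H v where H: "finite H" "H \<subseteq> \<X>\<^sub>2" "\<And>X. X \<in> H \<Longrightarrow> 0 \<le> v X" "sum v H = 1"
    "\<And>m. m \<in> K\<^sub>2 \<Longrightarrow> (\<Sum>X\<in>H. v X * of_bool (m \<in> X)) = y m"
    using assms(2) by (rule mixesE) blast
  have "r \<in> K\<^sub>2"
    using assms(4) by auto
  show ?thesis
  proof (rule mixes_glue_family[where A = F and B = H and p = u and q = v
        and P = "\<lambda>X. r \<in> X" and Q = "\<lambda>Z. r \<in> Z" and f = "\<lambda>X Z. (X \<inter> K\<^sub>1) \<union> (Z - K\<^sub>1)"])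
    show "sum u {x \<in> F. r \<in> x} = sum v {z \<in> H. r \<in> z}"
      using F(5)[OF assms(3)] H(5)[OF \<open>r \<in> K\<^sub>2\<close>]
      by (simp only: sum_of_bool_mult[OF F(1)] sum_of_bool_mult[OF H(1)])
    show "X \<inter> K\<^sub>1 \<union> (Z - K\<^sub>1) \<in> \<X>" if "X \<in> F" "Z \<in> H" "r \<in> X \<longleftrightarrow> r \<in> Z" for X Z
      using that F(2) H(2) glue by blast
    fix m assume "m \<in> K\<^sub>1 \<union> K\<^sub>2"
    then consider "m \<in> K\<^sub>1" | "m \<in> K\<^sub>2" "m \<notin> K\<^sub>1" by auto
    then show "(\<exists>g. (\<forall>x z. (r \<in> x) = (r \<in> z) \<longrightarrow> (m \<in> x \<inter> K\<^sub>1 \<union> (z - K\<^sub>1)) = g x) \<and> (\<Sum>x\<in>F. u x * of_bool (g x)) = y m) \<or>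
      (\<exists>g. (\<forall>x z. (r \<in> x) = (r \<in> z) \<longrightarrow> (m \<in> x \<inter> K\<^sub>1 \<union> (z - K\<^sub>1)) = g z) \<and> (\<Sum>z\<in>H. v z * of_bool (g z)) = y m)"
    proof cases
      case 1
      then show ?thesis using F(5)[of m] by (intro disjI1 exI[of _ "\<lambda>X. m \<in> X"]) auto
    next
      case 2
      then show ?thesis using H(5)[of m] by (intro disjI2 exI[of _ "\<lambda>X. m \<in> X"]) auto
    qed
  qed (use F(1-4) H(1-4) in auto)
qed

text \<open>With no constraint to respect, the coordinates are drawn independently: the trivial
  event turns the coupling into a product.\<close>

lemma mixes_cube:
  assumes "finite K" "\<And>m. m \<in> K \<Longrightarrow> 0 \<le> y m \<and> y m \<le> 1"
  shows "mixes K UNIV y"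
  using assms
proof (induction K rule: finite_induct)
  case empty
  show ?case
    unfolding mixes_def by (intro exI[of _ "{{}}"] exI[of _ "\<lambda>_. 1"]) simp
next
  case (insert m K)
  from insert have "mixes K UNIV y" by simp
  then obtain F u where F: "finite F" "\<And>X. X \<in> F \<Longrightarrow> 0 \<le> u X" "sum u F = 1"
    "\<And>k. k \<in> K \<Longrightarrow> (\<Sum>X\<in>F. u X * of_bool (k \<in> X)) = y k"
    by (rule mixesE) blast
  define q where "q b = (if b then y m else 1 - y m)" for b
  define f where "f X b = (X - {m}) \<union> {k. k = m \<and> b}" for X b
  have f: "m \<in> f X b \<longleftrightarrow> b" "k \<noteq> m \<Longrightarrow> k \<in> f X b \<longleftrightarrow> k \<in> X" for X b k
    by (auto simp: f_def)
  show ?case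
  proof (rule mixes_glue_family[where A = F and B = UNIV and p = u and q = q
        and P = "\<lambda>_. True" and Q = "\<lambda>_. True" and f = f])
    show "0 \<le> q b" for b
      using insert.prems[of m] by (simp add: q_def)
    show "sum q UNIV = 1"
      by (simp add: q_def UNIV_bool)
    then show "sum u {x \<in> F. True} = sum q {z \<in> UNIV. True}"
      using F(3) by simp
    fix k assume "k \<in> insert m K"
    then consider "k = m" | "k \<in> K" "k \<noteq> m" using insert.hyps by auto
    then show "(\<exists>g. (\<forall>x z. True = True \<longrightarrow> (k \<in> f x z) = g x) \<and> (\<Sum>x\<in>F. u x * of_bool (g x)) = y k) \<or>
        (\<exists>g. (\<forall>x z. True = True \<longrightarrow> (k \<in> f x z) = g z) \<and> (\<Sum>z\<in>UNIV. q z * of_bool (g z)) = y k)"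
    proof cases
      case 1
      then show ?thesis
        by (intro disjI2 exI[of _ "\<lambda>b. b"]) (simp add: f q_def UNIV_bool del: sum_mult_of_bool_eq)
    next
      case 2
      then show ?thesis
        using F(4)[of k] by (intro disjI1 exI[of _ "\<lambda>X. k \<in> X"]) (simp add: f)
    qed
  qed (use F in auto)
qed

text \<open>The event "\<open>f\<close> but not \<open>g\<close>" has total weight 0 and is
  therefore empty on the support. An equation between two coordinates of a mixed vector thus becomes
  an implication valid in every point that the mixture uses.\<close>

lemma convex_of_bool_eqD:
  fixes u :: "'i \<Rightarrow> real"
  assumes "finite I" "\<And>i. i \<in> I \<Longrightarrow> 0 \<le> u i" "\<And>i. i \<in> I \<Longrightarrow> g i \<Longrightarrow> f i"
    and eq: "(\<Sum>i\<in>I. u i * of_bool (f i)) = (\<Sum>i\<in>I. u i * of_bool (g i))"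
    and i: "i \<in> I" "u i \<noteq> 0" "f i"
  shows "g i"
proof -
  have "(\<Sum>i\<in>I. u i * of_bool (f i) - u i * of_bool (g i)) = 0"
    unfolding sum_subtractf eq by simp
  moreover have "0 \<le> u i * of_bool (f i) - u i * of_bool (g i)" if "i \<in> I" for i
    using assms(2,3) that by (auto simp: of_bool_def)
  ultimately have "u i * of_bool (f i) - u i * of_bool (g i) = 0"
    using sum_nonneg_0[of I "\<lambda>i. u i * of_bool (f i) - u i * of_bool (g i)" i] assms(1) i(1) by metis
  then show ?thesis using i by (cases "g i") auto
qed

section \<open>Convex hulls of finite sets\<close>

lemma fconv_hullE:
  assumes "x \<in> fconv_hull V"
  obtains u where "\<And>v. v \<in> V \<Longrightarrow> 0 \<le> u v" "sum u V = 1" "x = (\<lambda>m. \<Sum>v\<in>V. u v * v m)"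
  using assms unfolding fconv_hull_def by blast

lemma fconv_hull_family:
  fixes u :: "'i \<Rightarrow> real"
  assumes fin: "finite I" "finite V" and f: "\<And>i. i \<in> I \<Longrightarrow> f i \<in> V"
    and u: "\<And>i. i \<in> I \<Longrightarrow> 0 \<le> u i" "sum u I = 1"
    and x: "\<And>m. x m = (\<Sum>i\<in>I. u i * f i m)"
  shows "x \<in> fconv_hull V"
proof -
  define w where "w v = sum u {i \<in> I. f i = v}" for v
  have fV: "f ` I \<subseteq> V" using f by auto
  have "sum w V = sum u I"
    unfolding w_def by (rule sum.group[OF fin fV])
  moreover have "(\<Sum>v\<in>V. w v * v m) = x m" for m
  proof -
    have "(\<Sum>v\<in>V. w v * v m) = (\<Sum>v\<in>V. \<Sum>i\<in>{i \<in> I. f i = v}. u i * f i m)"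
      by (simp add: w_def sum_distrib_right)
    also have "\<dots> = (\<Sum>i\<in>I. u i * f i m)"
      by (rule sum.group[OF fin fV])
    finally show ?thesis using x by simp
  qed
  moreover have "\<forall>v\<in>V. 0 \<le> w v"
    using u by (auto simp: w_def intro: sum_nonneg)
  ultimately show ?thesis
    using u unfolding fconv_hull_def by (intro CollectI exI[of _ w]) (auto simp: fun_eq_iff)
qed

lemma fconv_hull_generator:
  assumes "finite V" "v \<in> V"
  shows "v \<in> fconv_hull V"
  by (rule fconv_hull_family[where I = "{v}" and u = "\<lambda>_. 1" and f = "\<lambda>v. v"]) (use assms in auto)

text \<open>If a generator has weight strictly between 0 and 1, then \<open>x\<close> lies strictly
  between it and the renormalised rest, so extremality makes the two coincide.\<close>

lemma extreme_point_of_hull_in_generators: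
  assumes fin: "finite V" and x: "is_extreme_point x (fconv_hull V)"
  shows "x \<in> V"
proof -
  have "x \<in> fconv_hull V"
    using x by (simp add: is_extreme_point_def)
  then obtain u where u: "\<And>v. v \<in> V \<Longrightarrow> 0 \<le> u v" "sum u V = 1" "x = (\<lambda>m. \<Sum>v\<in>V. u v * v m)"
    by (rule fconv_hullE) blast
  obtain v where v: "v \<in> V" "u v \<noteq> 0"
    using u(2) by (metis sum.neutral zero_neq_one)
  have split: "sum g V = g v + sum g (V - {v})" for g :: "_ \<Rightarrow> real"
    using fin v by (simp add: sum.remove)
  show ?thesis
  proof (cases "u v = 1")
    case True
    then have "sum u (V - {v}) = 0" using split[of u] u(2) by simp
    then have "u w = 0" if "w \<in> V - {v}" for w
      using that fin u(1) sum_nonneg_0[of "V - {v}" u w] by auto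
    then have "x = v"
      using True by (simp add: u(3) split)
    then show ?thesis using v by simp
  next
    case False
    have "0 \<le> sum u (V - {v})" using u(1) by (auto intro: sum_nonneg)
    then have t: "0 < u v" "u v < 1"
      using False v u(1)[of v] split[of u] u(2) by auto
    define b where "b = (\<lambda>m. \<Sum>w\<in>V - {v}. u w / (1 - u v) * w m)"
    have "b \<in> fconv_hull V"
      by (rule fconv_hull_family[where I = "V - {v}" and u = "\<lambda>w. u w / (1 - u v)" and f = "\<lambda>w. w"])
        (use fin t u(1) split[of u] u(2) in \<open>auto simp: b_def sum_divide_distrib[symmetric]\<close>)
    moreover have "v \<in> fconv_hull V"
      using fin v by (rule_tac fconv_hull_generator)
    moreover have x_eq: "x = (\<lambda>m. (1 - u v) * b m + u v * v m)"
      using t by (simp add: u(3) split b_def sum_distrib_left add.commute)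
    ultimately have "b = v"
      using x t unfolding is_extreme_point_def by metis
    then have "x = v" using x_eq by (auto simp: algebra_simps)
    then show ?thesis using v by simp
  qed
qed

text \<open>Integrality is known for extreme points only, so the hull has to be generated by them. A
  generating subset of least cardinality does this: a generator that is not extreme could be
  expressed by the others and dropped.\<close>

lemma hull_of_extreme_points:
  assumes fin: "finite V"
  shows "\<exists>V'\<subseteq>V. fconv_hull V' = fconv_hull V \<and> (\<forall>v\<in>V'. is_extreme_point v (fconv_hull V))"
proof -
  let ?Q = "fconv_hull V"
  obtain V' where V': "V' \<subseteq> V" "fconv_hull V' = ?Q"
    and min: "\<And>U. U \<subseteq> V \<Longrightarrow> fconv_hull U = ?Q \<Longrightarrow> card V' \<le> card U"
    using ex_has_least_nat[of "\<lambda>U. U \<subseteq> V \<and> fconv_hull U = ?Q" V card] by auto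
  have fin': "finite V'" using V' fin finite_subset by blast
  have "is_extreme_point v ?Q" if v: "v \<in> V'" for v
  proof (rule ccontr)
    assume "\<not> is_extreme_point v ?Q"
    moreover have "v \<in> ?Q" using fconv_hull_generator[OF fin' v] V' by simp
    ultimately obtain a b t where ab: "a \<in> ?Q" "b \<in> ?Q" "a \<noteq> b" and t: "0 < t" "t < (1::real)"
      and v_eq: "v = (\<lambda>m. (1 - t) * a m + t * b m)"
      unfolding is_extreme_point_def by blast
    obtain \<alpha> where \<alpha>: "\<And>v. v \<in> V' \<Longrightarrow> 0 \<le> \<alpha> v" "sum \<alpha> V' = 1" "a = (\<lambda>m. \<Sum>v\<in>V'. \<alpha> v * v m)"
      using ab(1)[folded V'(2)] by (rule fconv_hullE) blast
    obtain \<beta> where \<beta>: "\<And>v. v \<in> V' \<Longrightarrow> 0 \<le> \<beta> v" "sum \<beta> V' = 1" "b = (\<lambda>m. \<Sum>v\<in>V'. \<beta> v * v m)"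
      using ab(2)[folded V'(2)] by (rule fconv_hullE) blast
    define \<gamma> where "\<gamma> w = (1 - t) * \<alpha> w + t * \<beta> w" for w
    have split: "sum g V' = g v + sum g (V' - {v})" for g :: "_ \<Rightarrow> real"
      using fin' v by (simp add: sum.remove)
    have \<gamma>: "\<And>w. w \<in> V' \<Longrightarrow> 0 \<le> \<gamma> w" "sum \<gamma> V' = 1" "\<And>m. v m = (\<Sum>w\<in>V'. \<gamma> w * w m)"
    proof -
      show "0 \<le> \<gamma> w" if "w \<in> V'" for w
        using that \<alpha> \<beta> t by (simp add: \<gamma>_def)
      show "sum \<gamma> V' = 1"
        using \<alpha> \<beta> by (simp add: \<gamma>_def sum.distrib sum_distrib_left[symmetric])
      show "v m = (\<Sum>w\<in>V'. \<gamma> w * w m)" for m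
        by (subst v_eq) (simp add: \<gamma>_def \<alpha>(3) \<beta>(3) sum.distrib[symmetric] sum_distrib_left algebra_simps)
    qed
    have rest: "0 \<le> sum \<alpha> (V' - {v})" "0 \<le> sum \<beta> (V' - {v})"
      using \<alpha>(1) \<beta>(1) by (auto intro: sum_nonneg)
    \<comment> \<open>Otherwise \<open>a\<close> and \<open>b\<close> both put all their weight on
      \<open>v\<close> and coincide.\<close>
    have "\<gamma> v < 1"
    proof (rule ccontr)
      assume "\<not> \<gamma> v < 1"
      then have "1 \<le> \<gamma> v" by simp
      moreover have "\<alpha> v = 1 - sum \<alpha> (V' - {v})" "\<beta> v = 1 - sum \<beta> (V' - {v})"
        using split[of \<alpha>] split[of \<beta>] \<alpha>(2) \<beta>(2) by auto
      ultimately have le: "(1 - t) * sum \<alpha> (V' - {v}) + t * sum \<beta> (V' - {v}) \<le> 0"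
        by (simp add: \<gamma>_def algebra_simps)
      moreover have "0 \<le> (1 - t) * sum \<alpha> (V' - {v})" "0 \<le> t * sum \<beta> (V' - {v})"
        using rest t by auto
      ultimately have "(1 - t) * sum \<alpha> (V' - {v}) = 0" "t * sum \<beta> (V' - {v}) = 0"
        by linarith+
      then have z: "sum \<alpha> (V' - {v}) = 0" "sum \<beta> (V' - {v}) = 0"
        using t by auto
      have "\<alpha> w = 0" "\<beta> w = 0" if "w \<in> V' - {v}" for w
        using that fin' \<alpha>(1) \<beta>(1) z sum_nonneg_0[of "V' - {v}" \<alpha> w] sum_nonneg_0[of "V' - {v}" \<beta> w] by auto
      then have "a = b"
        using split[of \<alpha>] split[of \<beta>] \<alpha>(2) \<beta>(2) z by (simp add: \<alpha>(3) \<beta>(3) split)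
      then show False using ab by simp
    qed
    \<comment> \<open>The representation of \<open>v\<close> contains \<open>v\<close> itself with
      weight below 1, so it can be solved for \<open>v\<close>.\<close>
    have v_in: "v m = (\<Sum>w\<in>V' - {v}. \<gamma> w / (1 - \<gamma> v) * w m)" for m
    proof -
      have "(1 - \<gamma> v) * v m = (\<Sum>w\<in>V' - {v}. \<gamma> w * w m)"
        using \<gamma>(3)[of m] split[of "\<lambda>w. \<gamma> w * w m"] by (simp add: algebra_simps)
      then show ?thesis
        using \<open>\<gamma> v < 1\<close> by (simp add: sum_divide_distrib[symmetric] field_simps)
    qed
    have "x \<in> fconv_hull (V' - {v})" if x: "x \<in> fconv_hull V'" for x
    proof -
      obtain u where u: "\<And>v. v \<in> V' \<Longrightarrow> 0 \<le> u v" "sum u V' = 1" "x = (\<lambda>m. \<Sum>v\<in>V'. u v * v m)"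
        using x by (rule fconv_hullE) blast
      show ?thesis
      proof (rule fconv_hull_family[where I = "V' - {v}" and f = "\<lambda>w. w"
            and u = "\<lambda>w. u w + u v * (\<gamma> w / (1 - \<gamma> v))"])
        have "sum \<gamma> (V' - {v}) = 1 - \<gamma> v" "sum u (V' - {v}) = 1 - u v"
          using split[of \<gamma>] split[of u] \<gamma>(2) u(2) by auto
        then show "(\<Sum>w\<in>V' - {v}. u w + u v * (\<gamma> w / (1 - \<gamma> v))) = 1"
          using \<open>\<gamma> v < 1\<close>
          by (simp add: sum.distrib sum_distrib_left[symmetric] sum_divide_distrib[symmetric])
        show "x m = (\<Sum>w\<in>V' - {v}. (u w + u v * (\<gamma> w / (1 - \<gamma> v))) * w m)" for m
        proof -
          have "x m = u v * v m + (\<Sum>w\<in>V' - {v}. u w * w m)"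
            by (simp add: u(3) split)
          also have "u v * v m = (\<Sum>w\<in>V' - {v}. u v * (\<gamma> w / (1 - \<gamma> v)) * w m)"
            by (subst v_in) (simp add: sum_distrib_left mult.assoc)
          finally show ?thesis by (simp add: sum.distrib[symmetric] algebra_simps)
        qed
      qed (use u \<gamma> \<open>\<gamma> v < 1\<close> v fin' in auto)
    qed
    moreover have "x \<in> fconv_hull V'" if x: "x \<in> fconv_hull (V' - {v})" for x
    proof -
      obtain u where u: "\<And>w. w \<in> V' - {v} \<Longrightarrow> 0 \<le> u w" "sum u (V' - {v}) = 1"
        "x = (\<lambda>m. \<Sum>v\<in>V' - {v}. u v * v m)"
        using x by (rule fconv_hullE) blast
      show ?thesis
        by (rule fconv_hull_family[where I = "V' - {v}" and f = "\<lambda>w. w" and u = u]) (use u fin' in auto)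
    qed
    ultimately have "fconv_hull (V' - {v}) = ?Q"
      using V'(2) by blast
    then have "card V' \<le> card (V' - {v})"
      using V'(1) by (intro min) auto
    then show False
      using fin' v by (metis card_Diff1_less not_le)
  qed
  then show ?thesis using V' by blast
qed

section \<open>Integral duality for a single star\<close>

text \<open>Greedy: each element takes as much of \<open>D\<close> as its bound allows.\<close>

lemma distribute_int:
  fixes b :: "'a \<Rightarrow> int"
  assumes "finite c" "\<And>m. m \<in> c \<Longrightarrow> 0 \<le> b m" "0 \<le> D" "D \<le> sum b c"
  shows "\<exists>\<delta>. (\<forall>m\<in>c. 0 \<le> \<delta> m \<and> \<delta> m \<le> b m) \<and> sum \<delta> c = D"
  using assms
proof (induction c arbitrary: D rule: finite_induct)
  case (insert m c)
  define e where "e = min D (b m)"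
  have bm: "0 \<le> b m" using insert.prems(1) by simp
  have b: "\<And>k. k \<in> c \<Longrightarrow> 0 \<le> b k" using insert.prems(1) by simp
  have e: "0 \<le> e" "e \<le> b m" "0 \<le> D - e" "D - e \<le> sum b c"
    using insert.prems(2,3) insert.hyps bm sum_nonneg[of c b, OF b] by (auto simp: e_def min_def)
  obtain \<delta> where \<delta>: "\<forall>k\<in>c. 0 \<le> \<delta> k \<and> \<delta> k \<le> b k" "sum \<delta> c = D - e"
    using insert.IH[OF b e(3,4)] by metis
  have "sum (\<delta>(m := e)) c = sum \<delta> c"
    using insert.hyps by (intro sum.cong) auto
  then show ?case
    using \<delta> e insert.hyps by (intro exI[of _ "\<delta>(m := e)"]) auto
qed simp

text \<open>The maximum weight of a 0/1 point of a single star is either the total weight or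
  \<open>(\<Sum>m\<in>c. max (w m) 0) - \<mu>\<close> with \<open>\<mu>\<close> the least of the positive parts; in both cases the
  multiplier \<open>\<mu>\<close> on the last inequality is optimal.\<close>

lemma star_integral_dual:
  fixes w :: "'a \<Rightarrow> int"
  assumes c: "finite c" "c \<noteq> {}" "s \<notin> c"
  obtains \<alpha> \<beta> \<delta> :: "'a \<Rightarrow> int" and l :: int and X where
    "\<And>m. 0 \<le> \<alpha> m" "\<And>m. 0 \<le> \<beta> m" "\<And>m. 0 \<le> \<delta> m" "0 \<le> l"
    "\<And>m. m \<notin> insert s c \<Longrightarrow> \<alpha> m = 0" "\<And>m. m \<notin> insert s c \<Longrightarrow> \<beta> m = 0"
    "X \<subseteq> insert s c" "s \<in> X \<longleftrightarrow> c \<subseteq> X"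
    "\<alpha> s - \<beta> s + sum \<delta> c - l = w s"
    "\<And>m. m \<in> c \<Longrightarrow> \<alpha> m - \<beta> m + l - \<delta> m = w m"
    "sum \<alpha> (insert s c) + l * (int (card c) - 1) = sum w X"
proof -
  define pos where "pos m = max (w m) 0" for m
  define neg where "neg m = max (- w m) 0" for m
  have w: "w m = pos m - neg m" for m by (simp add: pos_def neg_def)
  have nn: "0 \<le> pos m" "0 \<le> neg m" for m by (simp_all add: pos_def neg_def)
  obtain a where a: "a \<in> c" and min: "\<And>m. m \<in> c \<Longrightarrow> pos a \<le> pos m"
    using ex_min_if_finite[of "pos ` c"] c by (metis (no_types, lifting) finite_imageI imageE imageI image_is_empty linorder_not_le)
  \<comment> \<open>With multiplier \<open>pos a\<close> on the AND row, \<open>d\<close> is what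
    the remaining rows must contribute at \<open>s\<close>. At \<open>m\<close> in \<open>c\<close>
    the upper bound takes \<open>pos m - pos a\<close>, and \<open>neg m\<close> is split between
    the domination row and the lower bound. The cases ask whether all of it can pass through the
    domination rows.\<close>
  define d where "d = w s + pos a"
  show thesis
  proof (cases "sum neg c \<le> d")
    case True
    show thesis
    proof (rule that[of "\<lambda>m. if m = s then d - sum neg c else if m \<in> c then pos m - pos a else 0"
          "\<lambda>_. 0" neg "pos a" "insert s c"])
      have "sum w c = sum pos c - sum neg c" by (simp add: w sum_subtractf)
      moreover have "(\<Sum>m\<in>c. if m = s then d - sum neg c else if m \<in> c then pos m - pos a else 0)
          = (\<Sum>m\<in>c. pos m - pos a)"
        using c(3) by (intro sum.cong) auto
      ultimately show "(\<Sum>m\<in>insert s c. if m = s then d - sum neg c else if m \<in> c then pos m - pos a else 0)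
          + pos a * (int (card c) - 1) = sum w (insert s c)"
        using c by (simp add: sum_subtractf d_def algebra_simps)
    qed (use True min nn c(3) in \<open>auto simp: w d_def\<close>)
  next
    case False
    \<comment> \<open>The domination rows carry only \<open>D\<close> in total; a negative
      \<open>d\<close> is made up by the lower bound at \<open>s\<close>.\<close>
    define D where "D = max 0 d"
    have "0 \<le> sum neg c" using nn by (simp add: sum_nonneg)
    then have D: "0 \<le> D" "D \<le> sum neg c" using False by (auto simp: D_def)
    obtain \<delta> where \<delta>: "\<And>m. m \<in> c \<Longrightarrow> 0 \<le> \<delta> m \<and> \<delta> m \<le> neg m" "sum \<delta> c = D"
      using distribute_int[OF c(1) _ D] nn by metis
    have sd: "(\<Sum>m\<in>c. if m \<in> c then \<delta> m else 0) = D"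
      using \<delta>(2) by (simp cong: sum.cong)
    show thesis
    proof (rule that[of "\<lambda>m. if m \<in> c then pos m - pos a else 0"
          "\<lambda>m. if m = s then D - d else if m \<in> c then neg m - \<delta> m else 0"
          "\<lambda>m. if m \<in> c then \<delta> m else 0" "pos a" "{m \<in> c. 0 \<le> w m} - {a}"])
      \<comment> \<open>Dropping \<open>a\<close> permits \<open>s\<close> to be 0 and costs exactly
        \<open>pos a\<close>, whatever the sign of \<open>w a\<close>.\<close>
      have "sum w ({m \<in> c. 0 \<le> w m} - {a}) = sum pos ({m \<in> c. 0 \<le> w m} - {a})"
        by (intro sum.cong) (auto simp: pos_def)
      also have "\<dots> = sum pos (c - {a})"
        using c(1) by (intro sum.mono_neutral_left) (auto simp: pos_def)
      also have "\<dots> = sum pos c - pos a" using c(1) a by (simp add: sum_diff1)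
      finally show "(\<Sum>m\<in>insert s c. if m \<in> c then pos m - pos a else 0)
          + pos a * (int (card c) - 1) = sum w ({m \<in> c. 0 \<le> w m} - {a})"
        using c by (simp add: sum_subtractf algebra_simps cong: sum.cong)
    qed (use min nn \<delta>(1) sd a c(3) in \<open>auto simp: w d_def D_def\<close>)
  qed
qed

section \<open>Simple linearizations\<close>

locale simple_linearization =
  fixes n :: nat and M :: "nat set set" and C :: "nat set set set"
  assumes lin: "linearization n M C" and cons: "consistent n M C" and simple: "simple_lin n M C"
begin

abbreviation "S \<equiv> singletons n"
abbreviation "P \<equiv> proper_monos n M"
abbreviation "A \<equiv> arcs_D C"
abbreviation "adj \<equiv> arc_adj A"
abbreviation "acyclic_on W \<equiv> \<not> (\<exists>vs. cyclic_walk adj vs \<and> set vs \<subseteq> W)"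

lemma M_sub: "m \<in> M \<Longrightarrow> m \<subseteq> {1..n}" "m \<in> M \<Longrightarrow> m \<noteq> {}"
  using lin by (auto simp: linearization_def)

lemma S_sub: "S \<subseteq> M"
  using lin by (auto simp: linearization_def)

lemma M_eq: "M = S \<union> P"
  using S_sub by (auto simp: proper_monos_def)

lemma finite_M: "finite M"
  by (rule finite_subset[of _ "Pow {1..n}"]) (use M_sub in auto)

lemma C_sub: "c \<in> C \<Longrightarrow> c \<subseteq> M" "c \<in> C \<Longrightarrow> \<Union>c \<in> M"
  using lin by (auto simp: linearization_def)

lemma finite_C: "finite C"
  by (rule finite_subset[of _ "Pow M"]) (use C_sub finite_M in auto)

lemma finite_c: "c \<in> C \<Longrightarrow> finite c"
  using C_sub finite_M finite_subset by blast

lemma star_sub: "c \<in> C \<Longrightarrow> star c \<subseteq> M"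
  using C_sub by simp

text \<open>Equality of the cardinalities rules out constraints whose resultant is a singleton.\<close>

lemma bij_Union: "bij_betw Union C P"
proof -
  define f where "f m = (THE c. c \<in> C \<and> \<Union>c = m)" for m
  have f: "f m \<in> C \<and> \<Union>(f m) = m" if "m \<in> P" for m
    unfolding f_def by (rule theI') (use simple that in \<open>auto simp: simple_lin_def\<close>)
  have inj: "inj_on f P"
    by (rule inj_on_inverseI[of _ Union]) (use f in auto)
  have "f ` P = C"
    using f inj simple finite_C
    by (intro card_subset_eq) (auto simp: card_image simple_lin_def)
  then show ?thesis
    by (intro bij_betw_byWitness[where f' = f]) (use f in auto)
qed

lemma Union_P: "c \<in> C \<Longrightarrow> \<Union>c \<in> P"
  using bij_Union by (auto simp: bij_betw_def)

lemma Union_inj: "c \<in> C \<Longrightarrow> c' \<in> C \<Longrightarrow> \<Union>c = \<Union>c' \<Longrightarrow> c = c'"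
  using bij_Union by (auto simp: bij_betw_def inj_on_def)

lemma P_obtain:
  assumes "m \<in> P" obtains c where "c \<in> C" "\<Union>c = m"
  using assms that bij_Union by (metis bij_betw_def imageE)

text \<open>Consistency provides some constraint with smaller members; injectivity of the resultant
  identifies it with \<open>c\<close>. Cardinality thus decreases along arcs and serves as the rank
  of the digraph.\<close>

lemma card_child:
  assumes "c \<in> C" "m \<in> c" shows "card m < card (\<Union>c)"
proof -
  obtain c' where "c' \<in> C" "\<Union>c' = \<Union>c" "\<forall>m'\<in>c'. card m' < card (\<Union>c)"
    using cons Union_P[OF assms(1)] by (auto simp: consistent_def)
  then show ?thesis using Union_inj assms by metis
qed

lemma c_nonempty: "c \<in> C \<Longrightarrow> c \<noteq> {}"
  using C_sub(2)[of c] M_sub(2)[of "\<Union>c"] by auto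

lemma Union_notin: "c \<in> C \<Longrightarrow> \<Union>c \<notin> c"
  using card_child[of c "\<Union>c"] by auto

lemma singleton_notin_P: "{i} \<notin> P"
  using M_sub(1)[of "{i}"] by (auto simp: proper_monos_def singletons_def)

lemma arcsE:
  assumes "(s, m) \<in> A" obtains c where "c \<in> C" "s = \<Union>c" "m \<in> c"
  using assms by (auto simp: arcs_D_def)

lemma arcsI: "c \<in> C \<Longrightarrow> m \<in> c \<Longrightarrow> (\<Union>c, m) \<in> A"
  by (auto simp: arcs_D_def)

lemma arcs_sub: "A \<subseteq> M \<times> M"
  using C_sub by (auto simp: arcs_D_def)

lemma arc_card: "(s, m) \<in> A \<Longrightarrow> card m < card s"
  by (auto elim!: arcsE simp: card_child)

lemma arc_subset: "(s, m) \<in> A \<Longrightarrow> m \<subseteq> s"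
  by (auto elim!: arcsE)

lemma reach_subset: "(s, m) \<in> A\<^sup>* \<Longrightarrow> m \<subseteq> s"
  by (induction rule: rtrancl_induct) (use arc_subset in auto)

lemma reach_card: "(s, m) \<in> A\<^sup>* \<Longrightarrow> s = m \<or> card m < card s"
proof (induction rule: rtrancl_induct)
  case (step y z)
  then show ?case using arc_card[of y z] by auto
qed simp

lemma adj_irrefl: "\<not> adj x x"
  using arc_card by (auto simp: arc_adj_def)

lemma succ_closed: "x \<in> succ A W \<Longrightarrow> (x, y) \<in> A\<^sup>* \<Longrightarrow> y \<in> succ A W"
  unfolding succ_def by (auto intro: rtrancl_trans)

lemma succ_superset: "W \<subseteq> succ A W"
  unfolding succ_def by auto

lemma succ_sub_M: "W \<subseteq> M \<Longrightarrow> succ A W \<subseteq> M"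
proof
  fix x assume W: "W \<subseteq> M" and "x \<in> succ A W"
  then obtain w where w: "w \<in> W" "(w, x) \<in> A\<^sup>*" by (auto simp: succ_def)
  from w(2) show "x \<in> M"
    by (cases rule: rtranclE) (use w W arcs_sub in auto)
qed

lemma star_sub_succ: "c \<in> C \<Longrightarrow> \<Union>c \<in> succ A W \<Longrightarrow> star c \<subseteq> succ A W"
  using arcsI[of c] succ_closed[of "\<Union>c" W] by (simp add: subset_iff r_into_rtrancl)

section \<open>Decomposing fractional points over a forest of stars\<close>

lemma leaf_star:
  assumes B: "B \<subseteq> C" "B \<noteq> {}" and W: "\<And>c. c \<in> B \<Longrightarrow> star c \<subseteq> W" and ac: "acyclic_on W"
  shows "\<exists>c\<in>B. \<exists>r\<in>star c. \<forall>c'\<in>B. c' \<noteq> c \<longrightarrow> star c \<inter> star c' \<subseteq> {r}"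
proof (rule leaf_hyperedge[where root = Union and kids = "\<lambda>c. c" and rank = card and W = W and adj = adj])
  show "finite B" using B finite_C finite_subset by metis
  show "\<Union>c = \<Union>c' \<Longrightarrow> c = c'" if "c \<in> B" "c' \<in> B" for c c'
    using that B Union_inj by (metis subsetD)
  fix c assume "c \<in> B"
  then have c: "c \<in> C" using B by (metis subsetD)
  then show "finite c" by (rule finite_c)
  fix m assume m: "m \<in> c"
  show "card m < card (\<Union>c)" "adj (\<Union>c) m" "adj m (\<Union>c)"
    using c m card_child arcsI by (auto simp: arc_adj_def)
qed (use assms in auto)

text \<open>The coordinate set \<open>K\<close> stays fixed while constraints are removed, so nodes
  that lie in no remaining star are treated as free coordinates of a cube.\<close>

lemma mixes_forest:
  assumes "B \<subseteq> C" "\<And>c. c \<in> B \<Longrightarrow> star c \<subseteq> W" "acyclic_on W"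
    and K: "finite K" "\<And>c. c \<in> B \<Longrightarrow> star c \<subseteq> K"
    and y: "\<And>m. m \<in> K \<Longrightarrow> 0 \<le> y m \<and> y m \<le> 1"
    "\<And>c m. c \<in> B \<Longrightarrow> m \<in> c \<Longrightarrow> y (\<Union>c) \<le> y m"
    "\<And>c. c \<in> B \<Longrightarrow> (\<Sum>m\<in>c. y m) \<le> y (\<Union>c) + real (card c) - 1"
  shows "mixes K {X. \<forall>c\<in>B. \<Union>c \<in> X \<longleftrightarrow> c \<subseteq> X} y"
proof -
  have "finite B" using assms(1) finite_C finite_subset by blast
  then show ?thesis
    using assms
  proof (induction B rule: finite_psubset_induct)
    case (psubset B)
    show ?case
    proof (cases "B = {}")
      case True
      then show ?thesis using mixes_cube[OF psubset.prems(4) psubset.prems(6)] by simp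
    next
      case False
      then obtain c r where c: "c \<in> B" "r \<in> star c"
        and leaf: "\<And>c'. c' \<in> B \<Longrightarrow> c' \<noteq> c \<Longrightarrow> star c \<inter> star c' \<subseteq> {r}"
        using leaf_star[OF psubset.prems(1) False psubset.prems(2,3)] by meson
      have cC: "c \<in> C" using c(1) psubset.prems(1) by (rule_tac subsetD)
      have cK: "star c \<subseteq> K" using psubset.prems(5) c(1) .
      \<comment> \<open>Only the nodes private to the leaf are removed: the overlap with its star is
        \<open>{r}\<close>, and all other stars of \<open>B\<close> stay inside
        \<open>K1\<close>.\<close>
      define K1 where "K1 = K - (star c - {r})"
      have "B - {c} \<subset> B" using c by auto
      then have "mixes K {X. \<forall>c\<in>B - {c}. \<Union>c \<in> X \<longleftrightarrow> c \<subseteq> X} y"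
      proof (rule psubset.IH)
        show "B - {c} \<subseteq> C" using psubset.prems(1) by auto
      qed (use psubset.prems(2-) in simp_all)
      then have m1: "mixes K1 {X. \<forall>c\<in>B - {c}. \<Union>c \<in> X \<longleftrightarrow> c \<subseteq> X} y"
        by (rule mixes_subset) (auto simp: K1_def)
      have m2: "mixes (star c) {X. \<Union>c \<in> X \<longleftrightarrow> c \<subseteq> X} y"
      proof (rule mixes_star)
        show "finite c" "c \<noteq> {}" "\<Union>c \<notin> c"
          using cC finite_c c_nonempty Union_notin by auto
        show "y (\<Union>c) \<le> y m \<and> y m \<le> 1" if "m \<in> c" for m
          using that psubset.prems(6)[of m] psubset.prems(7)[OF c(1) that] cK by auto
        show "0 \<le> y (\<Union>c)"
          using psubset.prems(6)[of "\<Union>c"] cK by simp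
        show "1 - y (\<Union>c) \<le> (\<Sum>m\<in>c. 1 - y m)"
          using psubset.prems(8)[OF c(1)] by (simp add: sum_subtractf)
      qed
      have "mixes (K1 \<union> star c) {X. \<forall>c\<in>B. \<Union>c \<in> X \<longleftrightarrow> c \<subseteq> X} y"
      proof (rule mixes_glue[OF m1 m2])
        show "r \<in> K1" "K1 \<inter> star c = {r}"
          using c cK by (auto simp: K1_def)
        fix X Z assume X: "X \<in> {X. \<forall>c\<in>B - {c}. \<Union>c \<in> X \<longleftrightarrow> c \<subseteq> X}"
          and Z: "Z \<in> {X. \<Union>c \<in> X \<longleftrightarrow> c \<subseteq> X}" and r: "r \<in> X \<longleftrightarrow> r \<in> Z"
        let ?Y = "X \<inter> K1 \<union> (Z - K1)"
        have "\<Union>c' \<in> ?Y \<longleftrightarrow> c' \<subseteq> ?Y" if c': "c' \<in> B" for c'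
        proof (cases "c' = c")
          case True
          have "m \<in> ?Y \<longleftrightarrow> m \<in> Z" if "m \<in> star c" for m
            using that r cK c(2) by (auto simp: K1_def)
          then show ?thesis using Z and_constraint_cong[of "\<Union>c" c ?Y Z] True by simp
        next
          case False
          have "star c' \<subseteq> K1"
          proof
            fix m assume m: "m \<in> star c'"
            then have "m \<in> K" "m \<in> star c \<Longrightarrow> m = r"
              using leaf[OF c' False] psubset.prems(5)[OF c'] by (metis subsetD, metis IntI singletonD subsetD)
            then show "m \<in> K1" by (metis DiffD1 DiffD2 DiffI K1_def singletonI)
          qed
          then have "m \<in> ?Y \<longleftrightarrow> m \<in> X" if "m \<in> star c'" for m
            using subsetD[OF _ that] by simp
          then show ?thesis using X False c' and_constraint_cong[of "\<Union>c'" c' ?Y X] by simp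
        qed
        then show "?Y \<in> {X. \<forall>c\<in>B. \<Union>c \<in> X \<longleftrightarrow> c \<subseteq> X}" by simp
      qed
      moreover have "K1 \<union> star c = K" using cK by (auto simp: K1_def)
      ultimately show ?thesis by simp
    qed
  qed
qed

section \<open>0/1 points of the relaxation: evaluations of the monomials at a set \<open>X\<close>
  of variables\<close>

definition point :: "nat set set \<Rightarrow> nat set \<Rightarrow> nat set \<Rightarrow> real" where
  "point K X m = of_bool (m \<in> K \<and> m \<subseteq> X)"

lemma relaxationD:
  assumes "y \<in> relaxation M C"
  shows "m \<notin> M \<Longrightarrow> y m = 0" "m \<in> M \<Longrightarrow> 0 \<le> y m" "m \<in> M \<Longrightarrow> y m \<le> 1"
    "c \<in> C \<Longrightarrow> m \<in> c \<Longrightarrow> y (\<Union>c) \<le> y m"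
    "c \<in> C \<Longrightarrow> (\<Sum>m\<in>c. y m) \<le> y (\<Union>c) + real (card c) - 1"
  using assms unfolding relaxation_def by auto

lemma point_in_relaxation: "point M X \<in> relaxation M C"
  unfolding relaxation_def
proof (intro CollectI conjI ballI allI impI)
  fix c m assume c: "c \<in> C" "m \<in> c"
  then have "m \<in> M" "\<Union>c \<in> M" using C_sub by auto
  then show "point M X (\<Union>c) \<le> point M X m"
    using c by (auto simp: point_def)
next
  fix c assume c: "c \<in> C"
  show "(\<Sum>m\<in>c. point M X m) \<le> point M X (\<Union>c) + real (card c) - 1"
  proof (cases "\<Union>c \<subseteq> X")
    case True
    have "(\<Sum>m\<in>c. point M X m) \<le> (\<Sum>m\<in>c. 1)"
      by (rule sum_mono) (auto simp: point_def)
    then show ?thesis using True C_sub[OF c] by (simp add: point_def)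
  next
    case False
    then obtain m where m: "m \<in> c" "\<not> m \<subseteq> X" by auto
    have pz: "point M X m = 0" using m by (simp add: point_def)
    have "(\<Sum>m\<in>c. point M X m) = (\<Sum>m\<in>c - {m}. point M X m)"
      using sum.remove[OF finite_c[OF c] m(1), of "point M X"] pz by simp
    also have "\<dots> \<le> (\<Sum>m\<in>c - {m}. 1)"
      by (rule sum_mono) (auto simp: point_def)
    also have "\<dots> = real (card c) - 1"
      using m(1) finite_c[OF c] by (simp add: of_nat_diff Suc_leI card_gt_0_iff c_nonempty[OF c])
    also have "\<dots> = point M X (\<Union>c) + real (card c) - 1"
      using False by (simp add: point_def)
    finally show ?thesis .
  qed
qed (auto simp: point_def)

lemma relaxation_convex:
  assumes fin: "finite I" and u: "\<And>i. i \<in> I \<Longrightarrow> 0 \<le> (u i :: real)" "sum u I = 1"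
    and g: "\<And>i. i \<in> I \<Longrightarrow> g i \<in> relaxation M C"
  shows "(\<lambda>m. \<Sum>i\<in>I. u i * g i m) \<in> relaxation M C"
  unfolding relaxation_def
proof (intro CollectI conjI ballI allI impI)
  show "(\<Sum>i\<in>I. u i * g i m) = 0" if "m \<notin> M" for m
    using that relaxationD(1)[OF g] by simp
  show "0 \<le> (\<Sum>i\<in>I. u i * g i m)" if "m \<in> M" for m
    using that relaxationD(2)[OF g] u by (auto intro!: sum_nonneg)
  show "(\<Sum>i\<in>I. u i * g i m) \<le> 1" if "m \<in> M" for m
  proof -
    have "(\<Sum>i\<in>I. u i * g i m) \<le> (\<Sum>i\<in>I. u i * 1)"
      using that relaxationD(3)[OF g] u by (intro sum_mono mult_left_mono) auto
    then show ?thesis using u by simp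
  qed
  show "(\<Sum>i\<in>I. u i * g i (\<Union>c)) \<le> (\<Sum>i\<in>I. u i * g i m)" if "c \<in> C" "m \<in> c" for c m
    using that relaxationD(4)[OF g] u by (intro sum_mono mult_left_mono) auto
  show "(\<Sum>m\<in>c. \<Sum>i\<in>I. u i * g i m) \<le> (\<Sum>i\<in>I. u i * g i (\<Union>c)) + real (card c) - 1" if c: "c \<in> C" for c
  proof -
    have "(\<Sum>m\<in>c. \<Sum>i\<in>I. u i * g i m) = (\<Sum>i\<in>I. u i * (\<Sum>m\<in>c. g i m))"
      by (subst sum.swap) (simp add: sum_distrib_left)
    also have "\<dots> \<le> (\<Sum>i\<in>I. u i * (g i (\<Union>c) + (real (card c) - 1)))"
      using relaxationD(5)[OF g c] u by (intro sum_mono mult_left_mono) (auto simp: algebra_simps)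
    also have "\<dots> = (\<Sum>i\<in>I. u i * g i (\<Union>c)) + (real (card c) - 1)"
      using u by (simp add: distrib_left sum.distrib sum_distrib_right[symmetric] del: distrib_left_numeral)
    finally show ?thesis by simp
  qed
qed

text \<open>By induction on cardinality, the domination rows or the AND row force each proper
  monomial to be the product of its children. Integrality is assumed at the singletons, which every
  projection onto \<open>S \<union> T\<close> retains.\<close>

lemma integral_point_eq:
  assumes y: "y \<in> relaxation M C" and int: "\<And>i. i \<in> {1..n} \<Longrightarrow> y {i} \<in> \<int>"
  shows "y = point M {i \<in> {1..n}. y {i} = 1}"
proof
  let ?X = "{i \<in> {1..n}. y {i} = 1}"
  fix m
  show "y m = point M ?X m"
  proof (cases "m \<in> M")
    case False
    then show ?thesis using relaxationD(1)[OF y] by (simp add: point_def)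
  next
    case True
    then show ?thesis
    proof (induction "card m" arbitrary: m rule: less_induct)
      case less
      consider "m \<in> S" | "m \<in> P" using less.prems M_eq by auto
      then show ?case
      proof cases
        case 1
        then obtain i where i: "i \<in> {1..n}" "m = {i}" by (auto simp: singletons_def)
        have "0 \<le> y {i}" "y {i} \<le> 1" using relaxationD(2,3)[OF y] less.prems i by auto
        then have "y {i} = 0 \<or> y {i} = 1"
          using int[OF i(1)] by (auto elim!: Ints_cases)
        then show ?thesis using i less.prems by (auto simp: point_def)
      next
        case 2
        then obtain c where c: "c \<in> C" "\<Union>c = m" by (rule P_obtain)
        have IH: "y k = point M ?X k" if "k \<in> c" for k
          using less.hyps[of k] card_child[OF c(1) that] c(2) subsetD[OF C_sub(1)[OF c(1)] that] by simp
        show ?thesis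
        proof (cases "m \<subseteq> ?X")
          case True
          have "(\<Sum>k\<in>c. y k) = (\<Sum>k\<in>c. 1)"
          proof (rule sum.cong)
            fix k assume k: "k \<in> c"
            then have "k \<subseteq> ?X" "k \<in> M" using True c C_sub by auto
            then show "y k = 1" using IH[OF k] by (simp add: point_def)
          qed simp
          then have "1 \<le> y m" using relaxationD(5)[OF y c(1)] c(2) by simp
          moreover have "y m \<le> 1" using relaxationD(3)[OF y less.prems] .
          ultimately show ?thesis using True less.prems by (simp add: point_def)
        next
          case False
          then obtain k where k: "k \<in> c" "\<not> k \<subseteq> ?X" using c by blast
          then have "y m \<le> 0" using relaxationD(4)[OF y c(1) k(1)] IH[OF k(1)] c(2) by (simp add: point_def)
          moreover have "0 \<le> y m" using relaxationD(2)[OF y less.prems] .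
          ultimately show ?thesis using False by (simp add: point_def)
        qed
      qed
    qed
  qed
qed

section \<open>A forest below \<open>T\<close> makes the projection integral\<close>

lemma proj_point: "K \<subseteq> M \<Longrightarrow> (\<lambda>m. if m \<in> K then point M X m else 0) = point K X"
  by (auto simp: point_def fun_eq_iff)

text \<open>The mixture respects only constraints with resultant in \<open>succ A T\<close>. This
  suffices for the coordinates in \<open>S \<union> T\<close>, since those constraints determine
  every node below \<open>T\<close> from the singletons. Conversely, each generator lifts to
  \<open>point M X\<close>.\<close>

lemma proj_eq_hull:
  assumes T: "T \<subseteq> P" and ac: "acyclic_on (succ A T)"
  shows "proj (S \<union> T) (relaxation M C) = fconv_hull (point (S \<union> T) ` Pow {1..n})"
    (is "_ = fconv_hull ?V")
proof
  let ?K = "S \<union> T"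
  have K: "?K \<subseteq> M" using T M_eq by auto
  have finV: "finite ?V" by simp
  show "proj ?K (relaxation M C) \<subseteq> fconv_hull ?V"
  proof
    fix x assume "x \<in> proj ?K (relaxation M C)"
    then obtain y where y: "y \<in> relaxation M C" and x: "x = (\<lambda>m. if m \<in> ?K then y m else 0)"
      unfolding proj_def by auto
    define B where "B = {c \<in> C. \<Union>c \<in> succ A T}"
    have "mixes M {X. \<forall>c\<in>B. \<Union>c \<in> X \<longleftrightarrow> c \<subseteq> X} y"
    proof (rule mixes_forest[where W = "succ A T"])
      show "star c \<subseteq> succ A T" if "c \<in> B" for c
        using that star_sub_succ by (auto simp: B_def)
      show "star c \<subseteq> M" if "c \<in> B" for c
        using that star_sub by (auto simp: B_def)
    qed (use ac finite_M relaxationD[OF y] in \<open>auto simp: B_def\<close>)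
    then obtain F u where F: "finite F" "F \<subseteq> {X. \<forall>c\<in>B. \<Union>c \<in> X \<longleftrightarrow> c \<subseteq> X}" "\<And>X. X \<in> F \<Longrightarrow> 0 \<le> u X" "sum u F = 1"
      "\<And>m. m \<in> M \<Longrightarrow> (\<Sum>X\<in>F. u X * of_bool (m \<in> X)) = y m"
      by (rule mixesE) blast
    \<comment> \<open>The assignment read off from the singletons; whatever \<open>X\<close> says
      about proper monomials outside \<open>succ A T\<close> is discarded.\<close>
    define ones where "ones X = {i \<in> {1..n}. {i} \<in> X}" for X
    have mem: "m \<in> X \<longleftrightarrow> m \<subseteq> ones X" if X: "X \<in> F" and m: "m \<in> S \<union> succ A T" for X m
      using m
    proof (induction "card m" arbitrary: m rule: less_induct)
      case less
      have "m \<in> M" using less.prems S_sub succ_sub_M[of T] T M_eq by auto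
      then consider "m \<in> S" | "m \<in> P" using M_eq by auto
      then show ?case
      proof cases
        case 1
        then show ?thesis by (auto simp: singletons_def ones_def)
      next
        case 2
        then obtain c where c: "c \<in> C" "\<Union>c = m" by (rule P_obtain)
        have "m \<in> succ A T" using 2 less.prems by (auto simp: proper_monos_def)
        then have cB: "c \<in> B" and sub: "star c \<subseteq> succ A T"
          using c star_sub_succ[OF c(1)] by (auto simp: B_def)
        have "m \<in> X \<longleftrightarrow> c \<subseteq> X" using F(2) X cB c by auto
        also have "\<dots> \<longleftrightarrow> (\<forall>k\<in>c. k \<subseteq> ones X)"
        proof -
          have "k \<in> X \<longleftrightarrow> k \<subseteq> ones X" if "k \<in> c" for k
            using less.hyps[of k] card_child[OF c(1) that] c(2) that sub by auto
          then show ?thesis by (simp add: subset_iff[of c X] Ball_def)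
        qed
        also have "\<dots> \<longleftrightarrow> m \<subseteq> ones X" using c(2) by auto
        finally show ?thesis .
      qed
    qed
    show "x \<in> fconv_hull ?V"
    proof (rule fconv_hull_family[where I = F and u = u and f = "\<lambda>X. point ?K (ones X)"])
      show "point ?K (ones X) \<in> ?V" if "X \<in> F" for X by (auto simp: ones_def)
      show "x m = (\<Sum>X\<in>F. u X * point ?K (ones X) m)" for m
      proof (cases "m \<in> ?K")
        case True
        then have "m \<in> S \<union> succ A T" "m \<in> M" using succ_superset K by auto
        then have "x m = (\<Sum>X\<in>F. u X * of_bool (m \<in> X))" using True F(5) x by auto
        also have "\<dots> = (\<Sum>X\<in>F. u X * point ?K (ones X) m)"
          using mem[OF _ \<open>m \<in> S \<union> succ A T\<close>] True by (intro sum.cong) (auto simp: point_def)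
        finally show ?thesis .
      next
        case False
        then show ?thesis by (simp add: x point_def)
      qed
    qed (use F finV in auto)
  qed
  show "fconv_hull ?V \<subseteq> proj ?K (relaxation M C)"
  proof
    fix x assume "x \<in> fconv_hull ?V"
    then obtain u where u: "\<And>v. v \<in> ?V \<Longrightarrow> 0 \<le> u v" "sum u ?V = 1" "x = (\<lambda>m. \<Sum>v\<in>?V. u v * v m)"
      by (rule fconv_hullE) blast
    have ex: "\<forall>v\<in>?V. \<exists>g. g \<in> relaxation M C \<and> v = (\<lambda>m. if m \<in> ?K then g m else 0)"
    proof
      fix v assume "v \<in> ?V"
      then obtain X where "v = point ?K X" by auto
      then show "\<exists>g. g \<in> relaxation M C \<and> v = (\<lambda>m. if m \<in> ?K then g m else 0)"
        using proj_point[OF K, of X] point_in_relaxation[of X] by (intro exI[of _ "point M X"]) simp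
    qed
    obtain g where "\<forall>v\<in>?V. g v \<in> relaxation M C \<and> v = (\<lambda>m. if m \<in> ?K then g v m else 0)"
      using bchoice[OF ex] by (elim exE)
    then have g: "\<And>v. v \<in> ?V \<Longrightarrow> g v \<in> relaxation M C"
      "\<And>v. v \<in> ?V \<Longrightarrow> v = (\<lambda>m. if m \<in> ?K then g v m else 0)"
      by auto
    have "(\<lambda>m. \<Sum>v\<in>?V. u v * g v m) \<in> relaxation M C"
      by (rule relaxation_convex) (use finV u g in auto)
    moreover have "x = (\<lambda>m. if m \<in> ?K then (\<Sum>v\<in>?V. u v * g v m) else 0)"
    proof
      fix m
      have "v m = (if m \<in> ?K then g v m else 0)" if "v \<in> ?V" for v
        using fun_cong[OF g(2)[OF that], of m] .
      then have "x m = (\<Sum>v\<in>?V. u v * (if m \<in> ?K then g v m else 0))"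
        unfolding u(3) by (intro sum.cong) auto
      then show "x m = (if m \<in> ?K then (\<Sum>v\<in>?V. u v * g v m) else 0)" by simp
    qed
    ultimately show "x \<in> proj ?K (relaxation M C)"
      unfolding proj_def by (intro image_eqI[where x = "\<lambda>m. \<Sum>v\<in>?V. u v * g v m"]) simp_all
  qed
qed

lemma acyclic_imp_integral:
  assumes "T \<subseteq> P" "acyclic_on (succ A T)"
  shows "integral_polytope (proj (S \<union> T) (relaxation M C))"
  unfolding integral_polytope_def
proof (intro conjI allI impI)
  let ?V = "point (S \<union> T) ` Pow {1..n}"
  have eq: "proj (S \<union> T) (relaxation M C) = fconv_hull ?V"
    by (rule proj_eq_hull[OF assms])
  have fin: "finite ?V" by simp
  then show "\<exists>V. finite V \<and> proj (S \<union> T) (relaxation M C) = fconv_hull V"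
    using eq by blast
  fix x m assume "is_extreme_point x (proj (S \<union> T) (relaxation M C))"
  then have "x \<in> ?V"
    unfolding eq by (rule extreme_point_of_hull_in_generators[OF fin])
  then show "x m \<in> \<int>" by (auto simp: point_def)
qed

section \<open>An integral projection forces a forest below \<open>T\<close>\<close>

text \<open>The projection is the hull of its extreme points. Each of these is integral and lifts to
  the relaxation, and its singleton coordinates make the lift an evaluation
  \<open>point M X\<close>. The vertices themselves serve as index set.\<close>

lemma integral_imp_mixture:
  assumes T: "T \<subseteq> P" and int: "integral_polytope (proj (S \<union> T) (relaxation M C))"
    and y: "y \<in> relaxation M C"
  obtains I :: "(nat set \<Rightarrow> real) set" and u X where "finite I" "\<And>i. i \<in> I \<Longrightarrow> 0 \<le> u i" "sum u I = 1"
    "\<And>m. m \<in> S \<union> T \<Longrightarrow> y m = (\<Sum>i\<in>I. u i * of_bool (m \<subseteq> X i))"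
proof -
  let ?K = "S \<union> T" let ?Q = "proj (S \<union> T) (relaxation M C)"
  have K: "?K \<subseteq> M" using T M_eq by auto
  obtain V where V: "finite V" "?Q = fconv_hull V"
    using int unfolding integral_polytope_def by blast
  obtain V' where V': "V' \<subseteq> V" "fconv_hull V' = ?Q" "\<And>v. v \<in> V' \<Longrightarrow> is_extreme_point v ?Q"
    using hull_of_extreme_points[OF V(1)] V(2) by metis
  have ex: "\<exists>X. v = point ?K X" if v: "v \<in> V'" for v
  proof -
    have "v \<in> ?Q" and vint: "\<And>m. v m \<in> \<int>"
      using V'(3)[OF v] int unfolding integral_polytope_def is_extreme_point_def by blast+
    then obtain z where z: "z \<in> relaxation M C" "v = (\<lambda>m. if m \<in> ?K then z m else 0)"
      unfolding proj_def by blast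
    have "z {i} \<in> \<int>" if "i \<in> {1..n}" for i
      using vint[of "{i}"] that by (auto simp: z(2) singletons_def)
    then have "z = point M {i \<in> {1..n}. z {i} = 1}"
      by (rule integral_point_eq[OF z(1)])
    then have "v = point ?K {i \<in> {1..n}. z {i} = 1}"
      using z(2) proj_point[OF K] by metis
    then show ?thesis by blast
  qed
  then obtain X where X: "\<And>v. v \<in> V' \<Longrightarrow> v = point ?K (X v)" by metis
  have "(\<lambda>m. if m \<in> ?K then y m else 0) \<in> fconv_hull V'"
    unfolding V'(2) proj_def using y by blast
  then obtain u where u: "\<And>v. v \<in> V' \<Longrightarrow> 0 \<le> u v" "sum u V' = 1"
    "(\<lambda>m. if m \<in> ?K then y m else 0) = (\<lambda>m. \<Sum>v\<in>V'. u v * v m)"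
    by (rule fconv_hullE) blast
  show thesis
  proof (rule that[of V' u X])
    show "finite V'" using V V' finite_subset by blast
    fix m assume m: "m \<in> ?K"
    have "y m = (\<Sum>v\<in>V'. u v * v m)" using fun_cong[OF u(3), of m] m by simp
    also have "\<dots> = (\<Sum>v\<in>V'. u v * of_bool (m \<subseteq> X v))"
    proof (rule sum.cong)
      fix v assume "v \<in> V'"
      then show "u v * v m = u v * of_bool (m \<subseteq> X v)"
        using fun_cong[OF X, of v m] m by (simp add: point_def)
    qed simp
    finally show "y m = (\<Sum>i\<in>V'. u i * of_bool (m \<subseteq> X i))" .
  qed (use u in auto)
qed

text \<open>A common ancestor of least cardinality. If it is neither \<open>p\<close> nor
  \<open>q\<close>, the first arcs towards them differ, since a common child would be a smaller
  common ancestor.\<close>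

lemma lca:
  assumes "(t, p) \<in> A\<^sup>*" "(t, q) \<in> A\<^sup>*"
  obtains s where "(t, s) \<in> A\<^sup>*" "s = p" "(p, q) \<in> A\<^sup>*"
  | s where "(t, s) \<in> A\<^sup>*" "s = q" "(q, p) \<in> A\<^sup>*"
  | s a b where "(t, s) \<in> A\<^sup>*" "a \<noteq> b" "(s, a) \<in> A" "(s, b) \<in> A" "(a, p) \<in> A\<^sup>*" "(b, q) \<in> A\<^sup>*"
proof -
  let ?anc = "\<lambda>s. (t, s) \<in> A\<^sup>* \<and> (s, p) \<in> A\<^sup>* \<and> (s, q) \<in> A\<^sup>*"
  obtain s where s: "?anc s" and min: "\<And>s'. ?anc s' \<Longrightarrow> card s \<le> card s'"
    using ex_has_least_nat[of ?anc t card] assms by auto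
  show thesis
  proof (cases "s = p \<or> s = q")
    case True
    then show ?thesis using s that(1,2) by metis
  next
    case False
    then obtain a b where ab: "(s, a) \<in> A" "(a, p) \<in> A\<^sup>*" "(s, b) \<in> A" "(b, q) \<in> A\<^sup>*"
      using s by (metis converse_rtranclE)
    have "a \<noteq> b"
    proof
      assume "a = b"
      then have "?anc a" using s ab by (metis rtrancl.rtrancl_into_rtrancl)
      then show False using min arc_card[OF ab(1)] by fastforce
    qed
    then show ?thesis using that(3) s ab by metis
  qed
qed

text \<open>The linking relation is reflexive, so \<open>i\<close> and \<open>j\<close> may be
  equal; in that form the lemma excludes nodes with two parents below one \<open>t\<close>.\<close>

lemma siblings_separated:
  assumes T: "T \<subseteq> P" and int: "integral_polytope (proj (S \<union> T) (relaxation M C))"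
    and t: "t \<in> T" "(t, s) \<in> A\<^sup>*"
    and ab: "(s, a) \<in> A" "(s, b) \<in> A" "a \<noteq> b" "i \<in> a" "j \<in> b"
    and ij: "(i, j) \<in> {(k, l). \<exists>t'\<in>T. (t', s) \<notin> A\<^sup>* \<and> k \<in> t' \<and> l \<in> t'}\<^sup>*"
  shows False
proof -
  define E where "E = {(k, l). \<exists>t'\<in>T. (t', s) \<notin> A\<^sup>* \<and> k \<in> t' \<and> l \<in> t'}"
  define F where "F = {k. (i, k) \<in> E\<^sup>*}"
  have iF: "i \<in> F" and jF: "j \<in> F"
    using ij by (auto simp: F_def E_def)
  have F_closed: "l \<in> F" if "t' \<in> T" "(t', s) \<notin> A\<^sup>*" "k \<in> t'" "k \<in> F" "l \<in> t'" for t' k l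
    using that by (auto simp: F_def E_def intro: rtrancl_into_rtrancl)
  have sP: "s \<in> P" and TM: "T \<subseteq> M"
    using ab(1) Union_P T M_eq by (auto elim!: arcsE)
  have i_t: "i \<in> t" and iM: "i \<in> {1..n}"
  proof -
    show "i \<in> t"
      using ab(1,4) t(2) arc_subset reach_subset by (meson subsetD)
    then show "i \<in> {1..n}"
      using M_sub(1) t(1) TM by (meson subsetD)
  qed
  define y where "y m = (if m \<notin> M \<or> (m, s) \<in> A\<^sup>* then 0 else if m \<inter> F \<noteq> {} then 1/2 else (1::real))" for m
  have y_bounds: "0 \<le> y m" "y m \<le> 1" for m
    by (auto simp: y_def)
  have y_half: "y m \<le> 1/2" if "m \<inter> F \<noteq> {}" for m
    using that by (auto simp: y_def)
  have y_single: "y {k} = (if k \<in> F then 1/2 else 1)" if "k \<in> {1..n}" for k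
  proof -
    have "({k}, s) \<notin> A\<^sup>*"
    proof
      assume "({k}, s) \<in> A\<^sup>*"
      then have "s \<subseteq> {k}" by (rule reach_subset)
      moreover have "s \<noteq> {}" using sP M_sub(2) M_eq by auto
      ultimately show False using sP singleton_notin_P by (metis subset_singletonD)
    qed
    moreover have "{k} \<in> M" using S_sub that by (auto simp: singletons_def)
    ultimately show ?thesis by (simp add: y_def)
  qed
  \<comment> \<open>In terms of slacks \<open>1 - y m\<close>, the members must cover the slack of
    the resultant. At \<open>s\<close> the two children supply 1/2 each; strictly above
    \<open>s\<close> some member has slack 1; elsewhere a resultant meeting \<open>F\<close> has
    slack 1/2 and so has one of its members, at least.\<close>
  have and_ineq: "1 - y (\<Union>c) \<le> (\<Sum>m\<in>c. 1 - y m)" if c: "c \<in> C" for c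
  proof -
    have le: "1 - y m \<le> (\<Sum>m\<in>c. 1 - y m)" if "m \<in> c" for m
      using that finite_c[OF c] y_bounds by (intro member_le_sum) auto
    consider "\<Union>c = s" | "\<Union>c \<noteq> s" "(\<Union>c, s) \<in> A\<^sup>*" | "(\<Union>c, s) \<notin> A\<^sup>*" by blast
    then show ?thesis
    proof cases
      case 1
      have "a \<in> c" "b \<in> c"
        using ab(1,2) 1 Union_inj[OF _ c] by (metis arcsE)+
      then have "(\<Sum>m\<in>{a, b}. 1 - y m) \<le> (\<Sum>m\<in>c. 1 - y m)"
        using finite_c[OF c] y_bounds by (intro sum_mono2) auto
      moreover have "y a \<le> 1/2" "y b \<le> 1/2"
        using y_half[of a] y_half[of b] iF jF ab by auto
      ultimately show ?thesis using ab(3) y_bounds(1)[of "\<Union>c"] by simp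
    next
      case 2
      then obtain m where m: "(\<Union>c, m) \<in> A" "(m, s) \<in> A\<^sup>*" by (metis converse_rtranclE)
      have "m \<in> c" using m(1) Union_inj[OF _ c] by (metis arcsE)
      moreover have "y m = 0" using m by (simp add: y_def)
      ultimately show ?thesis using le[of m] y_bounds(1)[of "\<Union>c"] by simp
    next
      case 3
      show ?thesis
      proof (cases "\<Union>c \<inter> F = {}")
        case True
        then have "y (\<Union>c) = 1" using 3 C_sub[OF c] by (simp add: y_def)
        then show ?thesis using y_bounds by (simp add: sum_nonneg)
      next
        case False
        then obtain m where m: "m \<in> c" "m \<inter> F \<noteq> {}" by auto
        have "y (\<Union>c) = 1/2" using 3 False C_sub[OF c] by (simp add: y_def)
        then show ?thesis using le[OF m(1)] y_half[OF m(2)] by simp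
      qed
    qed
  qed
  have y_mono: "y (\<Union>c) \<le> y m" if c: "c \<in> C" "m \<in> c" for c m
  proof -
    have M: "m \<in> M" "\<Union>c \<in> M" using C_sub[OF c(1)] c(2) by auto
    have "(m, s) \<in> A\<^sup>* \<Longrightarrow> (\<Union>c, s) \<in> A\<^sup>*"
      using arcsI[OF c] by (rule converse_rtrancl_into_rtrancl)
    moreover have "m \<inter> F \<noteq> {} \<Longrightarrow> \<Union>c \<inter> F \<noteq> {}" using c by auto
    ultimately show ?thesis using M by (auto simp: y_def)
  qed
  have "y \<in> relaxation M C"
    unfolding relaxation_def
  proof (intro CollectI conjI ballI allI impI)
    show "y m = 0" if "m \<notin> M" for m using that by (simp add: y_def)
    show "(\<Sum>m\<in>c. y m) \<le> y (\<Union>c) + real (card c) - 1" if "c \<in> C" for c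
      using and_ineq[OF that] by (simp add: sum_subtractf)
  qed (use y_bounds y_mono in auto)
  then obtain I :: "(nat set \<Rightarrow> real) set" and u X where I: "finite I" "\<And>v. v \<in> I \<Longrightarrow> 0 \<le> u v" "sum u I = 1"
    and y_eq: "\<And>m. m \<in> S \<union> T \<Longrightarrow> y m = (\<Sum>v\<in>I. u v * of_bool (m \<subseteq> X v))"
    by (rule integral_imp_mixture[OF T int]) blast
  have y_eq1: "y {k} = (\<Sum>v\<in>I. u v * of_bool (k \<in> X v))" if "k \<in> {1..n}" for k
    using y_eq[of "{k}"] that by (simp add: singletons_def)
  \<comment> \<open>Variables outside \<open>F\<close> have value 1, hence are present in every
    point of the support.\<close>
  have outside: "k \<in> X v" if v: "v \<in> I" "u v \<noteq> 0" and k: "k \<in> {1..n}" "k \<notin> F" for v k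
  proof (rule convex_of_bool_eqD[OF I(1,2), where f = "\<lambda>_. True" and i = v])
    show "(\<Sum>v\<in>I. u v * of_bool True) = (\<Sum>v\<in>I. u v * of_bool (k \<in> X v))"
      using y_eq1[OF k(1)] y_single[OF k(1)] k(2) I(3) by simp
  qed (use v in auto)
  \<comment> \<open>Both \<open>t'\<close> and the variable \<open>k\<close> have value 1/2, and
    containing \<open>t'\<close> implies containing \<open>k\<close>; on the support the two events
    coincide.\<close>
  have inside: "t' \<subseteq> X v" if v: "v \<in> I" "u v \<noteq> 0" and t': "t' \<in> T" "(t', s) \<notin> A\<^sup>*"
    and k: "k \<in> t'" "k \<in> F" "k \<in> X v" for v t' k
  proof (rule convex_of_bool_eqD[OF I(1,2), where f = "\<lambda>v. k \<in> X v" and i = v])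
    have kn: "k \<in> {1..n}" using k(1) t'(1) TM M_sub(1) by (meson subsetD)
    have "y t' = 1/2" using t' k TM by (auto simp: y_def)
    then show "(\<Sum>v\<in>I. u v * of_bool (k \<in> X v)) = (\<Sum>v\<in>I. u v * of_bool (t' \<subseteq> X v))"
      using y_eq1[OF kn] y_single[OF kn] k(2) y_eq[of t'] t'(1) by simp
  qed (use v k in auto)
  have const: "i \<in> X v \<longleftrightarrow> k \<in> X v" if v: "v \<in> I" "u v \<noteq> 0" and k: "k \<in> F" for v k
  proof -
    have "(i, k) \<in> E\<^sup>*" using k by (simp add: F_def)
    then show ?thesis
    proof (induction rule: rtrancl_induct)
      case (step k l)
      then obtain t' where t': "t' \<in> T" "(t', s) \<notin> A\<^sup>*" "k \<in> t'" "l \<in> t'" by (auto simp: E_def)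
      have kF: "k \<in> F" using step by (simp add: F_def)
      then have lF: "l \<in> F" using F_closed t' by metis
      have "k \<in> X v \<longleftrightarrow> l \<in> X v"
        using inside[OF v t'(1,2)] t'(3,4) kF lF by (meson subsetD)
      then show ?case using step by simp
    qed simp
  qed
  \<comment> \<open>On the support the variables of \<open>t\<close> in \<open>F\<close> agree with
    \<open>i\<close> and the others are present, so \<open>t\<close> and \<open>{i}\<close> have
    equal means. But \<open>y t\<close> is 0 and \<open>y {i}\<close> is 1/2.\<close>
  have "u v * of_bool (t \<subseteq> X v) = u v * of_bool (i \<in> X v)" if v: "v \<in> I" for v
  proof (cases "u v = 0")
    case False
    have "k \<in> X v" if "i \<in> X v" "k \<in> t" for k
    proof (cases "k \<in> F")
      case True
      then show ?thesis using const[OF v False] that by simp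
    next
      case notF: False
      have "k \<in> {1..n}" using that(2) t(1) TM M_sub(1) by (meson subsetD)
      then show ?thesis using outside[OF v False] notF by simp
    qed
    then have "t \<subseteq> X v \<longleftrightarrow> i \<in> X v" using i_t by blast
    then show ?thesis by simp
  qed simp
  then have "y t = y {i}"
    using y_eq[of t] y_eq1[OF iM] t(1) by (metis (no_types, lifting) UnI2 sum.cong)
  then show False
    using t(2) y_single[OF iM] iF by (simp add: y_def)
qed

text \<open>Two parents would give two children of one node that both reach \<open>x\<close>, and
  any variable of \<open>x\<close> lies in both.\<close>

lemma unique_parent:
  assumes T: "T \<subseteq> P" and int: "integral_polytope (proj (S \<union> T) (relaxation M C))"
    and t: "t \<in> T" and p: "(t, p) \<in> A\<^sup>*" "(p, x) \<in> A" and q: "(t, q) \<in> A\<^sup>*" "(q, x) \<in> A"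
  shows "p = q"
proof (rule ccontr)
  assume "p \<noteq> q"
  have "x \<in> M" using p(2) arcs_sub by auto
  then obtain i where i: "i \<in> x" using M_sub(2) by auto
  have no: False if "(t, s) \<in> A\<^sup>*" "(s, a) \<in> A" "(s, b) \<in> A" "a \<noteq> b" "(a, x) \<in> A\<^sup>*" "(b, x) \<in> A\<^sup>*" for s a b
  proof -
    have "i \<in> a" "i \<in> b" using reach_subset that(5,6) i by (meson subsetD)+
    then show False
      using siblings_separated[OF T int t that(1-4), of i i] by blast
  qed
  \<comment> \<open>If one parent lies above the other, the two siblings are \<open>x\<close> itself
    and the child of \<open>p\<close> on the way to \<open>q\<close>; cardinality keeps them
    apart.\<close>
  have desc: False if pq: "(t, p) \<in> A\<^sup>*" "(p, q) \<in> A\<^sup>*" "p \<noteq> q" "(p, x) \<in> A" "(q, x) \<in> A" for p q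
  proof -
    obtain b where b: "(p, b) \<in> A" "(b, q) \<in> A\<^sup>*" using pq(2,3) by (metis converse_rtranclE)
    have "card x < card q" using arc_card pq(5) by metis
    moreover have "card q \<le> card b" using reach_card[OF b(2)] by auto
    ultimately have "b \<noteq> x" by auto
    then show False
      using no[OF pq(1) b(1) pq(4)] b(2) pq(5) by (meson rtrancl.rtrancl_into_rtrancl rtrancl.rtrancl_refl)
  qed
  from p(1) q(1) show False
  proof (cases rule: lca)
    case 1
    then show ?thesis using desc[of p q] p q \<open>p \<noteq> q\<close> by metis
  next
    case 2
    then show ?thesis using desc[of q p] p q \<open>p \<noteq> q\<close> by metis
  next
    case (3 s a b)
    then show ?thesis using no[of s a b] p q by (meson rtrancl.rtrancl_into_rtrancl)
  qed
qed

text \<open>Adjacent nodes are nested and nonempty, so consecutive nodes of a path share a variable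
  through which the relation continues.\<close>

lemma connected_imp_related:
  assumes "(x, y) \<in> {(x, y). x \<in> W \<and> y \<in> W \<and> adj x y}\<^sup>*" "x \<in> W" and i: "i \<in> x" and "j \<in> y"
    and E: "\<And>x k l. x \<in> W \<Longrightarrow> k \<in> x \<Longrightarrow> l \<in> x \<Longrightarrow> (k, l) \<in> E"
  shows "(i, j) \<in> E\<^sup>*"
  using assms(1,4)
proof (induction arbitrary: j rule: rtrancl_induct)
  case base
  then show ?case using E[OF assms(2) i] by blast
next
  case (step y z)
  then have yz: "y \<in> W" "z \<in> W" "adj y z" by auto
  then have "y \<subseteq> z \<or> z \<subseteq> y" "y \<noteq> {}" "z \<noteq> {}"
    using arc_subset arcs_sub M_sub(2) by (auto simp: arc_adj_def)
  then obtain k where "k \<in> y" "k \<in> z" by auto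
  then show ?case using step.IH[of k] E[OF yz(2) _ step.prems] by (meson rtrancl.rtrancl_into_rtrancl)
qed

text \<open>Integrality is assumed for \<open>T\<close> only, so \<open>T\<close> stays fixed and
  the induction runs over the subset \<open>T\<^sub>0\<close> whose successors are examined.\<close>

lemma integral_imp_acyclic:
  assumes T: "T \<subseteq> P" and int: "integral_polytope (proj (S \<union> T) (relaxation M C))"
  shows "acyclic_on (succ A T)"
proof -
  have "acyclic_on (succ A T\<^sub>0)" if "finite T\<^sub>0" "T\<^sub>0 \<subseteq> T" for T\<^sub>0
    using that
  proof (induction T\<^sub>0 rule: finite_induct)
    case empty
    have "succ A {} = {}" by (simp add: succ_def)
    then show ?case by (auto simp: cyclic_walk_def)
  next
    case (insert t T1)
    define W where "W = succ A T1"
    have t: "t \<in> T" and ac: "acyclic_on W" using insert by (auto simp: W_def)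
    note unique = unique_parent[OF T int t]
    show ?case
    proof
      assume "\<exists>vs. cyclic_walk adj vs \<and> set vs \<subseteq> succ A (insert t T1)"
      then obtain vs where vs: "cyclic_walk adj vs" "set vs \<subseteq> succ A (insert t T1)" by blast
      define U where "U = set vs"
      have finU: "finite U" by (simp add: U_def)
      have nbr: "\<exists>y\<in>U. \<exists>z\<in>U. y \<noteq> z \<and> adj x y \<and> adj x z" if "x \<in> U" for x
        unfolding U_def
        by (rule cyclic_walk_neighbours[OF vs(1)]) (use that arc_adj_sym in \<open>auto simp: U_def\<close>)
      have out: "(t, x) \<in> A\<^sup>*" if "x \<in> U" "x \<notin> W" for x
        using that vs(2) unfolding U_def W_def succ_def by auto
      have W_closed: "y \<in> W" if "x \<in> W" "(x, y) \<in> A\<^sup>*" for x y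
        using that succ_closed unfolding W_def by metis
      \<comment> \<open>\<open>W\<close> is closed under arcs, so a cycle can leave it only towards
        a parent.\<close>
      have par: "(y, x) \<in> A" if "x \<in> W" "y \<notin> W" "adj x y" for x y
        using that W_closed unfolding arc_adj_def by (metis r_into_rtrancl)
      show False
      proof (cases "U \<inter> W = {}")
        case True
        \<comment> \<open>At a node of least cardinality both neighbours on the cycle are parents,
          and all lie below \<open>t\<close>.\<close>
        have "U \<noteq> {}" using vs(1) by (auto simp: U_def cyclic_walk_def)
        then obtain x where x: "x \<in> U" and min: "\<And>y. y \<in> U \<Longrightarrow> card x \<le> card y"
          using ex_has_least_nat[of "\<lambda>x. x \<in> U" _ card] by (metis ex_in_conv)
        obtain y z where yz: "y \<in> U" "z \<in> U" "y \<noteq> z" "adj x y" "adj x z"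
          using nbr[OF x] by metis
        have "(y, x) \<in> A" "(z, x) \<in> A"
          using yz min[of y] min[of z] arc_card unfolding arc_adj_def by (metis not_le)+
        moreover have "(t, y) \<in> A\<^sup>*" "(t, z) \<in> A\<^sup>*"
          using out yz True by (metis IntI empty_iff)+
        ultimately show False using unique yz(3) by metis
      next
        case False
        \<comment> \<open>\<open>K\<close> is the component of \<open>m\<close> in the part of the
          graph on the cycle's nodes that lies in \<open>W\<close>.\<close>
        define G where "G = {(x, y). x \<in> U \<inter> W \<and> y \<in> U \<inter> W \<and> adj x y}"
        obtain m where m: "m \<in> U \<inter> W" using False by auto
        define K where "K = {x. (m, x) \<in> G\<^sup>*}"
        have mK: "m \<in> K" by (simp add: K_def)
        have K_sub: "x \<in> U \<and> x \<in> W" if "x \<in> K" for x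
        proof -
          have "(m, x) \<in> G\<^sup>*" using that by (simp add: K_def)
          then show ?thesis by (cases rule: rtranclE) (use m in \<open>auto simp: G_def\<close>)
        qed
        have K_closed: "y \<in> K" if "x \<in> K" "y \<in> U" "y \<in> W" "adj x y" for x y
          using that K_sub[of x] unfolding K_def G_def by (auto intro: rtrancl_into_rtrancl)
        \<comment> \<open>If arcs from outside \<open>W\<close> entered \<open>K\<close> at
          \<open>x\<^sub>0\<close> only, all other nodes would keep two neighbours in
          \<open>K\<close>, and \<open>W\<close> would contain a cycle.\<close>
        have another: "\<exists>x\<^sub>1\<in>K. x\<^sub>1 \<noteq> x\<^sub>0 \<and> (\<exists>p\<in>U. p \<notin> W \<and> (p, x\<^sub>1) \<in> A)" if x0: "x\<^sub>0 \<in> K" for x\<^sub>0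
        proof (rule ccontr)
          assume none: "\<not> ?thesis"
          \<comment> \<open>Without a neighbour in \<open>K\<close>, \<open>x\<^sub>0\<close> would
            have two parents below \<open>t\<close>.\<close>
          have "\<exists>b\<in>K. adj x\<^sub>0 b"
          proof (rule ccontr)
            assume no_b: "\<not> ?thesis"
            obtain y z where yz: "y \<in> U" "z \<in> U" "y \<noteq> z" "adj x\<^sub>0 y" "adj x\<^sub>0 z"
              using nbr K_sub[OF x0] by metis
            have "y \<notin> W" "z \<notin> W" using yz no_b K_closed[OF x0] by metis+
            then have "(t, y) \<in> A\<^sup>*" "(t, z) \<in> A\<^sup>*" "(y, x\<^sub>0) \<in> A" "(z, x\<^sub>0) \<in> A"
              using out par yz K_sub[OF x0] by metis+
            then show False using unique yz(3) by metis
          qed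
          then obtain b where b: "b \<in> K" "adj x\<^sub>0 b" by metis
          have "\<exists>vs. cyclic_walk adj vs \<and> set vs \<subseteq> K"
          proof (rule cyclic_walk_if_dense[OF _ arc_adj_sym adj_irrefl x0 b])
            show "finite K" by (rule finite_subset[OF _ finU]) (use K_sub in auto)
            fix x assume x: "x \<in> K" "x \<noteq> x\<^sub>0"
            obtain y z where yz: "y \<in> U" "z \<in> U" "y \<noteq> z" "adj x y" "adj x z"
              using nbr K_sub[OF x(1)] by metis
            have "y \<in> W" "z \<in> W" using yz none x par K_sub[OF x(1)] by metis+
            then show "\<exists>y\<in>K. \<exists>z\<in>K. y \<noteq> z \<and> adj x y \<and> adj x z"
              using yz K_closed[OF x(1)] by metis
          qed
          then show False using ac K_sub by (meson subsetD subsetI)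
        qed
        obtain m1 p1 where m1: "m1 \<in> K" "p1 \<in> U" "p1 \<notin> W" "(p1, m1) \<in> A"
          using another[OF mK] by metis
        obtain m2 p2 where m2: "m2 \<in> K" "p2 \<in> U" "p2 \<notin> W" "(p2, m2) \<in> A" "m2 \<noteq> m1"
          using another[OF m1(1)] by metis
        have tp: "(t, p1) \<in> A\<^sup>*" "(t, p2) \<in> A\<^sup>*" using out m1 m2 by metis+
        \<comment> \<open>The path from \<open>s\<close> to \<open>x\<close> ends with the only
          parent of \<open>x\<close> below \<open>t\<close>, namely \<open>p\<close>. If
          \<open>s\<close> were in \<open>W\<close>, so would be \<open>p\<close>.\<close>
        have above: "s \<notin> W" if s: "(t, s) \<in> A\<^sup>*" "(s, x) \<in> A\<^sup>*" "s \<noteq> x"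
          and x: "(p, x) \<in> A" "p \<notin> W" "(t, p) \<in> A\<^sup>*" for s x p
        proof
          assume "s \<in> W"
          obtain q where q: "(s, q) \<in> A\<^sup>*" "(q, x) \<in> A" using s(2,3) by (metis rtranclE)
          have "q \<in> W" using W_closed \<open>s \<in> W\<close> q(1) by metis
          moreover have "q = p" using unique[OF _ q(2) x(3,1)] s(1) q(1) by (meson rtrancl_trans)
          ultimately show False using x(2) by simp
        qed
        have tm: "(t, m1) \<in> A\<^sup>*" "(t, m2) \<in> A\<^sup>*"
          using tp m1(4) m2(4) by (meson rtrancl.rtrancl_into_rtrancl)+
        from tm show False
        proof (cases rule: lca)
          case 1
          then show False using above[OF tm(1) _ _ m2(4,3) tp(2)] m2(5) K_sub[OF m1(1)] by metis
        next
          case 2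
          then show False using above[OF tm(2) _ _ m1(4,3) tp(1)] m2(5) K_sub[OF m2(1)] by metis
        next
          case (3 s a b)
          have "(s, m1) \<in> A\<^sup>*" using 3 by (meson converse_rtrancl_into_rtrancl)
          moreover have "s \<noteq> m1"
          proof
            assume "s = m1"
            then have "card a < card m1" "m1 = a \<or> card m1 < card a"
              using 3 arc_card reach_card[of a m1] by auto
            then show False by auto
          qed
          ultimately have "s \<notin> W" using above 3(1) m1 tp by metis
          have mM: "m1 \<noteq> {}" "m2 \<noteq> {}"
            using m1(4) m2(4) arcs_sub M_sub(2) by auto
          then obtain i j where ij: "i \<in> m1" "j \<in> m2" by auto
          have "i \<in> a" "j \<in> b" using ij 3 reach_subset by (meson subsetD)+
          \<comment> \<open>No member of \<open>T1\<close> reaches \<open>s\<close>. Hence each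
            cycle node in \<open>W\<close> has its variables linked by a member above it, and the
            component carries the links from \<open>m1\<close> to \<open>m2\<close>.\<close>
          moreover have "(i, j) \<in> {(k, l). \<exists>t'\<in>T. (t', s) \<notin> A\<^sup>* \<and> k \<in> t' \<and> l \<in> t'}\<^sup>*"
          proof (rule connected_imp_related[of m1 m2 "U \<inter> W"])
            have "sym G" using arc_adj_sym by (auto simp: G_def sym_def)
            then have "(m1, m) \<in> G\<^sup>*"
              using m1(1) by (auto simp: K_def dest: sym_rtrancl symD)
            then show "(m1, m2) \<in> {(x, y). x \<in> U \<inter> W \<and> y \<in> U \<inter> W \<and> adj x y}\<^sup>*"
              unfolding G_def[symmetric] using m2(1) by (auto simp: K_def)
            show "(k, l) \<in> {(k, l). \<exists>t'\<in>T. (t', s) \<notin> A\<^sup>* \<and> k \<in> t' \<and> l \<in> t'}"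
              if x: "x \<in> U \<inter> W" "k \<in> x" "l \<in> x" for x k l
            proof -
              obtain t' where t': "t' \<in> T1" "(t', x) \<in> A\<^sup>*" using x(1) by (auto simp: W_def succ_def)
              have "(t', s) \<notin> A\<^sup>*" using \<open>s \<notin> W\<close> t'(1) by (auto simp: W_def succ_def)
              moreover have "k \<in> t'" "l \<in> t'" using reach_subset[OF t'(2)] x by auto
              moreover have "t' \<in> T" using t' insert.prems by auto
              ultimately show ?thesis by blast
            qed
          qed (use K_sub[OF m1(1)] ij in auto)
          ultimately show False
            by (rule siblings_separated[OF T int t 3(1) 3(3,4,2)])
        qed
      qed
    qed
  qed
  moreover have "finite T" by (rule finite_subset[OF _ finite_M]) (use T M_eq in auto)
  ultimately show ?thesis by blast
qed

subsection \<open>Total dual integrality\<close>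

abbreviation "rows \<equiv> ineq_index M C"

definition coef :: "(ineq \<Rightarrow> real) \<Rightarrow> nat set \<Rightarrow> real" where
  "coef u k = (\<Sum>i\<in>rows. u i * ineq_lhs i k)"

definition dual_value :: "(ineq \<Rightarrow> real) \<Rightarrow> real" where
  "dual_value u = (\<Sum>i\<in>rows. ineq_rhs i * u i)"

lemma coef_add: "coef (\<lambda>i. u i + v i) k = coef u k + coef v k"
  by (simp add: coef_def distrib_right sum.distrib)

lemma dual_value_add: "dual_value (\<lambda>i. u i + v i) = dual_value u + dual_value v"
  by (simp add: dual_value_def distrib_left sum.distrib)

lemma sum_rows: "sum f rows = (\<Sum>m\<in>M. f (UpperB m)) + (\<Sum>m\<in>M. f (LowerB m)) +
    (\<Sum>c\<in>C. \<Sum>m\<in>c. f (Dom c m)) + (\<Sum>c\<in>C. f (AndC c))" for f :: "ineq \<Rightarrow> real"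
proof -
  define Ds where "Ds = (\<lambda>(c, m). Dom c m) ` (SIGMA c:C. c)"
  have rows: "rows = ((UpperB ` M \<union> LowerB ` M) \<union> Ds) \<union> AndC ` C"
    unfolding ineq_index_def Ds_def by auto
  have fin: "finite Ds" using finite_C finite_c by (auto simp: Ds_def)
  have "sum f Ds = (\<Sum>(c, m)\<in>(SIGMA c:C. c). f (Dom c m))"
    unfolding Ds_def by (subst sum.reindex) (auto simp: inj_on_def case_prod_unfold)
  also have "\<dots> = (\<Sum>c\<in>C. \<Sum>m\<in>c. f (Dom c m))"
    using finite_C finite_c by (intro sum.Sigma[symmetric]) auto
  finally have "sum f Ds = (\<Sum>c\<in>C. \<Sum>m\<in>c. f (Dom c m))" .
  moreover have "sum f rows = sum f (UpperB ` M) + sum f (LowerB ` M) + sum f Ds + sum f (AndC ` C)"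
    unfolding rows using finite_M finite_C fin
    by (subst sum.union_disjoint; (auto simp: Ds_def)[1])+
  ultimately show ?thesis
    by (simp add: sum.reindex inj_on_def)
qed


text \<open>Feasibility of \<open>x\<close> is demanded only on rows with nonzero multiplier, so a
  dual supported on one star can be tested against points that respect just that star.\<close>

lemma weak_duality:
  assumes "\<And>i. i \<in> rows \<Longrightarrow> 0 \<le> u i"
    and "\<And>i. i \<in> rows \<Longrightarrow> u i \<noteq> 0 \<Longrightarrow> (\<Sum>k\<in>M. ineq_lhs i k * x k) \<le> ineq_rhs i"
  shows "(\<Sum>k\<in>M. coef u k * x k) \<le> dual_value u"
proof -
  have "(\<Sum>k\<in>M. coef u k * x k) = (\<Sum>i\<in>rows. u i * (\<Sum>k\<in>M. ineq_lhs i k * x k))"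
    unfolding coef_def sum_distrib_right sum_distrib_left
    by (subst sum.swap) (simp add: mult.assoc)
  also have "\<dots> \<le> (\<Sum>i\<in>rows. u i * ineq_rhs i)"
  proof (rule sum_mono)
    fix i assume "i \<in> rows"
    then show "u i * (\<Sum>k\<in>M. ineq_lhs i k * x k) \<le> u i * ineq_rhs i"
      using assms by (cases "u i = 0") (auto intro: mult_left_mono)
  qed
  finally show ?thesis by (simp add: dual_value_def mult.commute)
qed

text \<open>The AND-constraints that a 0/1 vector must respect for the row to hold; the bounds need
  none.\<close>

fun row_constraint :: "ineq \<Rightarrow> nat set set set" where
  "row_constraint (UpperB m) = {}"
| "row_constraint (LowerB m) = {}"
| "row_constraint (Dom c m) = {c}"
| "row_constraint (AndC c) = {c}"

lemma indicator_feasible: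
  assumes i: "i \<in> rows" and X: "\<And>c. c \<in> row_constraint i \<Longrightarrow> \<Union>c \<in> X \<longleftrightarrow> c \<subseteq> X"
  shows "(\<Sum>k\<in>M. ineq_lhs i k * of_bool (k \<in> X)) \<le> ineq_rhs i"
proof -
  have pick: "(\<Sum>k\<in>M. (if k = m then 1 else 0) * of_bool (k \<in> X)) = (of_bool (m \<in> X) :: real)" if "m \<in> M" for m
    using that finite_M by (simp add: if_distrib[of "\<lambda>a. a * _"] sum.delta cong: if_cong)
  consider m where "m \<in> M" "i = UpperB m" | m where "m \<in> M" "i = LowerB m"
    | c m where "c \<in> C" "m \<in> c" "i = Dom c m" | c where "c \<in> C" "i = AndC c"
    using i unfolding ineq_index_def by auto
  then show ?thesis
  proof cases
    case 1
    then show ?thesis using pick by simp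
  next
    case 2
    have "(\<Sum>k\<in>M. ineq_lhs i k * of_bool (k \<in> X)) \<le> 0"
      by (rule sum_nonpos) (simp add: 2)
    then show ?thesis using 2 by simp
  next
    case 3
    have "m \<in> M" "\<Union>c \<in> M" using 3 C_sub by auto
    then have "(\<Sum>k\<in>M. ineq_lhs i k * of_bool (k \<in> X)) = of_bool (\<Union>c \<in> X) - of_bool (m \<in> X)"
      by (simp only: 3 ineq_lhs.simps left_diff_distrib sum_subtractf pick)
    moreover have "\<Union>c \<in> X \<longrightarrow> m \<in> X" using X[of c] 3 by auto
    ultimately show ?thesis using 3 by auto
  next
    case 4
    have M: "c \<subseteq> M" "\<Union>c \<in> M" using 4 C_sub by auto
    have "(\<Sum>k\<in>M. (if k \<in> c then 1 else 0) * of_bool (k \<in> X)) = (\<Sum>k\<in>c. of_bool (k \<in> X) :: real)"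
      using M finite_M by (intro sum.mono_neutral_cong_right) auto
    then have eq: "(\<Sum>k\<in>M. ineq_lhs i k * of_bool (k \<in> X)) = (\<Sum>k\<in>c. of_bool (k \<in> X)) - of_bool (\<Union>c \<in> X)"
      by (simp only: 4 ineq_lhs.simps left_diff_distrib sum_subtractf pick[OF M(2)])
    have fin: "finite c" using 4 finite_c by simp
    have le: "(\<Sum>k\<in>c'. of_bool (k \<in> X)) \<le> real (card c')" for c'
    proof -
      have "(\<Sum>k\<in>c'. of_bool (k \<in> X)) \<le> (\<Sum>k\<in>c'. 1 :: real)" by (rule sum_mono) simp
      then show ?thesis by simp
    qed
    show ?thesis
    proof (cases "\<Union>c \<in> X")
      case True
      then show ?thesis using eq le[of c] 4 by simp
    next
      case False
      then have "\<not> c \<subseteq> X" using X[of c] 4 by simp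
      then obtain m where m: "m \<in> c" "m \<notin> X" by blast
      have "(\<Sum>k\<in>c. of_bool (k \<in> X)) = (\<Sum>k\<in>c - {m}. of_bool (k \<in> X) :: real)"
        using sum.remove[OF fin m(1), of "\<lambda>k. of_bool (k \<in> X) :: real"] m(2) by simp
      also have "\<dots> \<le> real (card (c - {m}))" by (rule le)
      also have "\<dots> = real (card c) - 1"
        using m(1) fin by (simp add: of_nat_diff Suc_leI card_gt_0_iff c_nonempty[OF 4(1)])
      finally show ?thesis using eq False 4 by simp
    qed
  qed
qed

text \<open>Embeds the multipliers of one star into the full system, with zeros on the rows of all
  other constraints.\<close>

lemma star_rows_dual:
  fixes w :: "nat set \<Rightarrow> int"
  assumes c: "c \<in> C" and supp: "\<And>k. k \<notin> star c \<Longrightarrow> w k = 0"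
  obtains u :: "ineq \<Rightarrow> int" and X where "\<And>i. 0 \<le> u i"
    "\<And>i c'. u i \<noteq> 0 \<Longrightarrow> c' \<in> row_constraint i \<Longrightarrow> c' = c"
    "X \<subseteq> star c" "\<Union>c \<in> X \<longleftrightarrow> c \<subseteq> X"
    "\<And>k. k \<in> M \<Longrightarrow> coef (\<lambda>i. real_of_int (u i)) k = real_of_int (w k)"
    "dual_value (\<lambda>i. real_of_int (u i)) = real_of_int (sum w X)"
proof -
  let ?s = "\<Union>c"
  have fin: "finite c" and s: "?s \<notin> c" and sM: "star c \<subseteq> M" "?s \<in> M" "c \<subseteq> M"
    using finite_c[OF c] Union_notin[OF c] star_sub[OF c] by auto
  obtain \<alpha> \<beta> \<delta> :: "nat set \<Rightarrow> int" and l :: int and X where *: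
    "\<And>m. 0 \<le> \<alpha> m" "\<And>m. 0 \<le> \<beta> m" "\<And>m. 0 \<le> \<delta> m" "0 \<le> l"
    "\<And>m. m \<notin> star c \<Longrightarrow> \<alpha> m = 0" "\<And>m. m \<notin> star c \<Longrightarrow> \<beta> m = 0"
    "X \<subseteq> star c" "?s \<in> X \<longleftrightarrow> c \<subseteq> X"
    "\<alpha> ?s - \<beta> ?s + sum \<delta> c - l = w ?s"
    "\<And>m. m \<in> c \<Longrightarrow> \<alpha> m - \<beta> m + l - \<delta> m = w m"
    "sum \<alpha> (star c) + l * (int (card c) - 1) = sum w X"
    by (rule star_integral_dual[OF fin c_nonempty[OF c] s, of w]) blast
  define u where "u i = (case i of UpperB m \<Rightarrow> \<alpha> m | LowerB m \<Rightarrow> \<beta> m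
    | Dom c' m \<Rightarrow> if c' = c then \<delta> m else 0 | AndC c' \<Rightarrow> if c' = c then l else 0)" for i
  have u_simps: "u (UpperB m) = \<alpha> m" "u (LowerB m) = \<beta> m" "u (Dom c' m) = (if c' = c then \<delta> m else 0)"
    "u (AndC c') = (if c' = c then l else 0)" for m c'
    by (simp_all add: u_def)
  have only_c: "(\<Sum>c'\<in>C. if c' = c then g c' else 0) = g c" for g :: "nat set set \<Rightarrow> real"
    using c finite_C by simp
  have only_m: "(\<Sum>m\<in>c'. if c' = c then g m else 0) = (if c' = c then sum g c else 0)" for g :: "nat set \<Rightarrow> real" and c'
    by simp
  show thesis
  proof (rule that[of u X])
    show "0 \<le> u i" for i using *(1-4) by (cases i) (auto simp: u_simps)
    show "c' = c" if "u i \<noteq> 0" "c' \<in> row_constraint i" for i c'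
      using that by (cases i) (auto simp: u_simps split: if_splits)
    show "coef (\<lambda>i. real_of_int (u i)) k = real_of_int (w k)" if k: "k \<in> M" for k
    proof -
      have "coef (\<lambda>i. real_of_int (u i)) k
          = real_of_int (\<alpha> k) - real_of_int (\<beta> k)
          + (\<Sum>m\<in>c. real_of_int (\<delta> m) * ((if k = ?s then 1 else 0) - (if k = m then 1 else 0)))
          + real_of_int l * ((if k \<in> c then 1 else 0) - (if k = ?s then 1 else 0))"
      proof -
        have "(\<Sum>m\<in>M. real_of_int (u (UpperB m)) * ineq_lhs (UpperB m) k) = real_of_int (\<alpha> k)"
          using k finite_M by (simp add: u_simps if_distrib cong: if_cong)
        moreover have "(\<Sum>m\<in>M. real_of_int (u (LowerB m)) * ineq_lhs (LowerB m) k) = - real_of_int (\<beta> k)"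
          using k finite_M by (simp add: u_simps if_distrib cong: if_cong)
        moreover have "(\<Sum>c'\<in>C. \<Sum>m\<in>c'. real_of_int (u (Dom c' m)) * ineq_lhs (Dom c' m) k)
          = (\<Sum>c'\<in>C. if c' = c then (\<Sum>m\<in>c'. real_of_int (\<delta> m) * ineq_lhs (Dom c' m) k) else 0)"
          by (intro sum.cong) (auto simp: u_simps)
        moreover have "(\<Sum>c'\<in>C. real_of_int (u (AndC c')) * ineq_lhs (AndC c') k)
          = (\<Sum>c'\<in>C. if c' = c then real_of_int l * ineq_lhs (AndC c') k else 0)"
          by (intro sum.cong) (auto simp: u_simps)
        ultimately show ?thesis
          unfolding coef_def sum_rows only_c by simp
      qed
      also have "(\<Sum>m\<in>c. real_of_int (\<delta> m) * ((if k = ?s then 1 else 0) - (if k = m then 1 else 0)))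
          = (if k = ?s then real_of_int (sum \<delta> c) else 0) - (if k \<in> c then real_of_int (\<delta> k) else 0)"
      proof -
        have "(\<Sum>m\<in>c. real_of_int (\<delta> m) * ((if k = ?s then 1 else 0) - (if k = m then 1 else 0)))
            = (\<Sum>m\<in>c. if k = ?s then real_of_int (\<delta> m) else 0) - (\<Sum>m\<in>c. if k = m then real_of_int (\<delta> m) else 0)"
          unfolding sum_subtractf[symmetric] by (intro sum.cong) auto
        then show ?thesis using fin by simp
      qed
      also have "real_of_int (\<alpha> k) - real_of_int (\<beta> k) +
         ((if k = ?s then real_of_int (sum \<delta> c) else 0) - (if k \<in> c then real_of_int (\<delta> k) else 0))
          + real_of_int l * ((if k \<in> c then 1 else 0) - (if k = ?s then 1 else 0)) = real_of_int (w k)"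
      proof -
        consider "k = ?s" | "k \<in> c" "k \<noteq> ?s" | "k \<notin> star c" by auto
        then show ?thesis
        proof cases
          case 1
          then show ?thesis using arg_cong[OF *(9), of real_of_int] s by simp
        next
          case 2
          then show ?thesis using arg_cong[OF *(10)[of k], of real_of_int] by simp
        next
          case 3
          then show ?thesis using *(5,6)[of k] supp[of k] by simp
        qed
      qed
      finally show ?thesis .
    qed
    have "dual_value (\<lambda>i. real_of_int (u i)) = (\<Sum>m\<in>M. real_of_int (\<alpha> m)) + (real (card c) - 1) * real_of_int l"
    proof -
      have "(\<Sum>c'\<in>C. ineq_rhs (AndC c') * real_of_int (u (AndC c')))
          = (\<Sum>c'\<in>C. if c' = c then (real (card c') - 1) * real_of_int l else 0)"
        by (intro sum.cong) (auto simp: u_simps)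
      then show ?thesis unfolding dual_value_def sum_rows only_c by (simp add: u_simps)
    qed
    also have "(\<Sum>m\<in>M. real_of_int (\<alpha> m)) = (\<Sum>m\<in>star c. real_of_int (\<alpha> m))"
      using *(5) sM finite_M by (intro sum.mono_neutral_right) auto
    also have "\<dots> + (real (card c) - 1) * real_of_int l = real_of_int (sum \<alpha> (star c) + l * (int (card c) - 1))"
      by simp
    finally show "dual_value (\<lambda>i. real_of_int (u i)) = real_of_int (sum w X)"
      unfolding *(11) .
  qed (use *(7,8) in auto)
qed


text \<open>Subtracting \<open>h\<close> from the weight of the shared node \<open>r\<close> makes both values of \<open>r\<close> optimal
  in the leaf star, so that any solution of the rest of the forest extends.\<close>

lemma forest_integral_dual:
  assumes "B \<subseteq> C" "\<And>c. c \<in> B \<Longrightarrow> star c \<subseteq> W" "acyclic_on W"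
  shows "\<exists>X (u :: ineq \<Rightarrow> int). X \<subseteq> M \<and> (\<forall>c\<in>B. \<Union>c \<in> X \<longleftrightarrow> c \<subseteq> X) \<and> (\<forall>i. 0 \<le> u i) \<and>
    (\<forall>k\<in>M. coef (\<lambda>i. real_of_int (u i)) k = real_of_int (w k)) \<and>
    dual_value (\<lambda>i. real_of_int (u i)) = real_of_int (sum w X)"
proof -
  have "finite B" using assms(1) finite_C finite_subset by metis
  then show ?thesis
    using assms
  proof (induction B arbitrary: w rule: finite_psubset_induct)
    case (psubset B)
    show ?case
    proof (cases "B = {}")
      case True
      \<comment> \<open>Only bounds are used: positive weights go to upper bounds, negative ones to
        lower bounds.\<close>
      define u where "u i = (case i of UpperB m \<Rightarrow> max (w m) 0 | LowerB m \<Rightarrow> max (- w m) 0 | _ \<Rightarrow> 0)" for i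
      have u_simps: "u (UpperB m) = max (w m) 0" "u (LowerB m) = max (- w m) 0" "u (Dom c m) = 0" "u (AndC c) = 0" for m c
        by (simp_all add: u_def)
      have "coef (\<lambda>i. real_of_int (u i)) k = real_of_int (w k)" if k: "k \<in> M" for k
      proof -
        have "(\<Sum>m\<in>M. real_of_int (u (UpperB m)) * ineq_lhs (UpperB m) k) = real_of_int (max (w k) 0)"
          using k finite_M by (simp add: u_simps if_distrib cong: if_cong)
        moreover have "(\<Sum>m\<in>M. real_of_int (u (LowerB m)) * ineq_lhs (LowerB m) k) = - real_of_int (max (- w k) 0)"
          using k finite_M by (simp add: u_simps if_distrib cong: if_cong)
        ultimately show ?thesis
          unfolding coef_def sum_rows by (simp add: u_simps del: of_int_max)
      qed
      moreover have "dual_value (\<lambda>i. real_of_int (u i)) = real_of_int (sum w {m \<in> M. 0 \<le> w m})"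
      proof -
        have "(\<Sum>m\<in>M. real_of_int (max (w m) 0)) = real_of_int (sum w {m \<in> M. 0 \<le> w m})"
          unfolding of_int_sum using finite_M by (intro sum.mono_neutral_cong_right) auto
        then show ?thesis unfolding dual_value_def sum_rows by (simp add: u_simps del: of_int_max)
      qed
      moreover have "0 \<le> u i" for i by (cases i) (simp_all add: u_simps)
      ultimately show ?thesis
        using True by (intro exI[of _ "{m \<in> M. 0 \<le> w m}"] exI[of _ u]) simp
    next
      case False
      then obtain c r where c: "c \<in> B" "r \<in> star c"
        and leaf: "\<And>c'. c' \<in> B \<Longrightarrow> c' \<noteq> c \<Longrightarrow> star c \<inter> star c' \<subseteq> {r}"
        using leaf_star[OF psubset.prems(1) False psubset.prems(2,3)] by meson
      have cC: "c \<in> C" using c(1) psubset.prems(1) by (rule_tac subsetD)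
      define R where "R = star c"
      have R: "R \<subseteq> M" "finite R" "r \<in> R"
        using star_sub[OF cC] finite_c[OF cC] c(2) by (simp_all add: R_def)
      \<comment> \<open>The 0/1 points of the leaf star with the value of \<open>r\<close>
        prescribed.\<close>
      define feas where "feas v X \<longleftrightarrow> X \<subseteq> R \<and> (\<Union>c \<in> X \<longleftrightarrow> c \<subseteq> X) \<and> (r \<in> X \<longleftrightarrow> v)" for v X
      have "\<exists>X. feas v X \<and> (\<forall>Y. feas v Y \<longrightarrow> sum w Y \<le> sum w X)" for v
      proof -
        have fin: "finite {X. feas v X}"
          by (rule finite_subset[of _ "Pow R"]) (use R in \<open>auto simp: feas_def\<close>)
        have "feas v (if v then R else {})"
          using R(3) c_nonempty[OF cC] by (auto simp: feas_def R_def)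
        then have ne: "{X. feas v X} \<noteq> {}" by blast
        have "finite (sum w ` {X. feas v X})" "sum w ` {X. feas v X} \<noteq> {}"
          using fin ne by auto
        then have "Max (sum w ` {X. feas v X}) \<in> sum w ` {X. feas v X}"
          and "\<And>Y. feas v Y \<Longrightarrow> sum w Y \<le> Max (sum w ` {X. feas v X})"
          by (rule Max_in) (use fin in \<open>auto intro: Max_ge\<close>)
        then show ?thesis by (metis (mono_tags, lifting) imageE mem_Collect_eq)
      qed
      then obtain best where best: "\<And>v. feas v (best v)" "\<And>v Y. feas v Y \<Longrightarrow> sum w Y \<le> sum w (best v)"
        by metis
      \<comment> \<open>The gain in the leaf from switching \<open>r\<close> on. This weight is
        charged to \<open>r\<close> in the remaining problem \<open>w2\<close>, where nodes private
        to the leaf get weight 0.\<close>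
      define h where "h = sum w (best True) - sum w (best False)"
      define w1 where "w1 k = (if k \<in> R then w k - (if k = r then h else 0) else 0)" for k
      define w2 where "w2 k = (if k \<in> R then (if k = r then h else 0) else w k)" for k
      have w_eq: "w k = w1 k + w2 k" for k using R(3) by (auto simp: w1_def w2_def)
      have w1_sum: "sum w1 X = sum w X - (if r \<in> X then h else 0)" if "X \<subseteq> R" for X
      proof -
        have "finite X" using that R(2) finite_subset by metis
        have "sum w1 X = (\<Sum>k\<in>X. w k - (if k = r then h else 0))"
          using that by (intro sum.cong) (auto simp: w1_def)
        then show ?thesis using \<open>finite X\<close> by (simp add: sum_subtractf)
      qed
      obtain u1 X1 where u1: "\<And>i. 0 \<le> u1 i" "\<And>i c'. u1 i \<noteq> 0 \<Longrightarrow> c' \<in> row_constraint i \<Longrightarrow> c' = c"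
        "X1 \<subseteq> star c" "\<Union>c \<in> X1 \<longleftrightarrow> c \<subseteq> X1"
        "\<And>k. k \<in> M \<Longrightarrow> coef (\<lambda>i. real_of_int (u1 i)) k = real_of_int (w1 k)"
        "dual_value (\<lambda>i. real_of_int (u1 i)) = real_of_int (sum w1 X1)"
        by (rule star_rows_dual[OF cC, of w1]) (auto simp: w1_def R_def)
      \<comment> \<open>The upper bound is the choice of \<open>best\<close>. The lower bound is
        weak duality against \<open>best False\<close>, which respects \<open>c\<close>, the only
        constraint whose rows \<open>u1\<close> uses.\<close>
      have opt: "sum w1 X1 = sum w (best False)"
      proof (rule antisym)
        have "feas (r \<in> X1) X1" using u1(3,4) by (simp add: feas_def R_def)
        then show "sum w1 X1 \<le> sum w (best False)"
          using best(2)[of "r \<in> X1" X1] w1_sum[of X1] u1(3) by (cases "r \<in> X1") (simp_all add: h_def R_def)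
        let ?X0 = "best False"
        have X0: "?X0 \<subseteq> R" "\<Union>c \<in> ?X0 \<longleftrightarrow> c \<subseteq> ?X0" "r \<notin> ?X0"
          using best(1)[of False] by (auto simp: feas_def)
        have "(\<Sum>k\<in>M. coef (\<lambda>i. real_of_int (u1 i)) k * of_bool (k \<in> ?X0)) \<le> dual_value (\<lambda>i. real_of_int (u1 i))"
        proof (rule weak_duality)
          show "(\<Sum>k\<in>M. ineq_lhs i k * of_bool (k \<in> ?X0)) \<le> ineq_rhs i"
            if "i \<in> rows" "real_of_int (u1 i) \<noteq> 0" for i
            using that(1) by (rule indicator_feasible) (use u1(2) that(2) X0(2) in auto)
        qed (use u1(1) in simp)
        also have "(\<Sum>k\<in>M. coef (\<lambda>i. real_of_int (u1 i)) k * of_bool (k \<in> ?X0)) = real_of_int (sum w1 ?X0)"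
          unfolding of_int_sum using X0(1) R(1) finite_M u1(5)
          by (intro sum.mono_neutral_cong_right) auto
        finally have "sum w1 ?X0 \<le> sum w1 X1"
          unfolding u1(6) by (simp only: of_int_le_iff)
        then show "sum w ?X0 \<le> sum w1 X1"
          using w1_sum[OF X0(1)] X0(3) by simp
      qed
      have "B - {c} \<subset> B" using c by auto
      then have "\<exists>X (u :: ineq \<Rightarrow> int). X \<subseteq> M \<and> (\<forall>c\<in>B - {c}. \<Union>c \<in> X \<longleftrightarrow> c \<subseteq> X) \<and> (\<forall>i. 0 \<le> u i) \<and>
        (\<forall>k\<in>M. coef (\<lambda>i. real_of_int (u i)) k = real_of_int (w2 k)) \<and>
        dual_value (\<lambda>i. real_of_int (u i)) = real_of_int (sum w2 X)"
      proof (rule psubset.IH)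
        show "B - {c} \<subseteq> C" using psubset.prems(1) by auto
      qed (use psubset.prems(2,3) in simp_all)
      then obtain X2 and u2 :: "ineq \<Rightarrow> int" where X2: "X2 \<subseteq> M" "\<forall>c\<in>B - {c}. \<Union>c \<in> X2 \<longleftrightarrow> c \<subseteq> X2"
        and u2: "\<forall>i. 0 \<le> u2 i" "\<forall>k\<in>M. coef (\<lambda>i. real_of_int (u2 i)) k = real_of_int (w2 k)"
        "dual_value (\<lambda>i. real_of_int (u2 i)) = real_of_int (sum w2 X2)"
        by (elim exE conjE) blast
      \<comment> \<open>The remaining problem decides the value of \<open>r\<close>; the leaf is
        then filled with its best point having that value.\<close>
      define Z where "Z = best (r \<in> X2)"
      have Z: "Z \<subseteq> R" "\<Union>c \<in> Z \<longleftrightarrow> c \<subseteq> Z" "r \<in> Z \<longleftrightarrow> r \<in> X2"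
        using best(1)[of "r \<in> X2"] by (simp_all add: feas_def Z_def)
      define X where "X = (X2 - R) \<union> Z"
      have finX: "finite X2" "finite Z"
        using X2(1) Z(1) R(2) finite_M finite_subset by metis+
      have XM: "X \<subseteq> M" using X2(1) Z(1) R(1) by (auto simp: X_def)
      have Xfeas: "\<Union>c' \<in> X \<longleftrightarrow> c' \<subseteq> X" if c': "c' \<in> B" for c'
      proof (cases "c' = c")
        case True
        have "m \<in> X \<longleftrightarrow> m \<in> Z" if "m \<in> star c" for m
          using that by (simp add: X_def R_def)
        then show ?thesis using Z(2) and_constraint_cong[of "\<Union>c" c X Z] True by simp
      next
        case False
        have "m \<in> X \<longleftrightarrow> m \<in> X2" if m: "m \<in> star c'" for m
        proof (cases "m \<in> R")
          case True
          then have "m = r" using leaf[OF c' False] m unfolding R_def by (metis IntI singletonD subsetD)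
          then show ?thesis using Z(3) R(3) by (simp add: X_def)
        next
          case False
          then show ?thesis using Z(1) by (auto simp: X_def)
        qed
        then show ?thesis using X2(2) False c' and_constraint_cong[of "\<Union>c'" c' X X2] by simp
      qed
      have "sum w X = sum w (X2 - R) + sum w Z"
        unfolding X_def using finX Z(1) by (intro sum.union_disjoint) auto
      also have "sum w (X2 - R) = sum w2 (X2 - R)"
        by (intro sum.cong) (auto simp: w2_def)
      also have "sum w Z = sum w (best False) + (if r \<in> X2 then h else 0)"
        by (simp add: Z_def h_def)
      also have "(if r \<in> X2 then h else 0) = sum w2 (X2 \<inter> R)"
      proof -
        have "sum w2 (X2 \<inter> R) = (\<Sum>k\<in>X2 \<inter> R. if k = r then h else 0)"
          by (intro sum.cong) (auto simp: w2_def)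
        then show ?thesis using finX R(3) by simp
      qed
      finally have "sum w X = sum w1 X1 + sum w2 X2"
        using opt sum.Int_Diff[OF finX(1), of w2 R] by simp
      then have "dual_value (\<lambda>i. real_of_int (u1 i + u2 i)) = real_of_int (sum w X)"
        using u1(6) u2(3) by (simp add: dual_value_add)
      moreover have "coef (\<lambda>i. real_of_int (u1 i + u2 i)) k = real_of_int (w k)" if "k \<in> M" for k
        using u1(5) u2(2) that w_eq[of k] by (simp add: coef_add)
      moreover have "0 \<le> u1 i + u2 i" for i using u1(1)[of i] u2(1) by simp
      ultimately show ?thesis
        using XM Xfeas by (intro exI[of _ X] exI[of _ "\<lambda>i. u1 i + u2 i"]) simp
    qed
  qed
qed

text \<open>The integral dual attains the weight of a feasible 0/1 point \<open>X\<close>, so weak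
  duality at \<open>X\<close> certifies its optimality among all dual solutions.\<close>

lemma acyclic_imp_TDI:
  assumes "acyclic_on W" "\<And>c. c \<in> C \<Longrightarrow> star c \<subseteq> W"
  shows "TDI rows M ineq_lhs ineq_rhs"
  unfolding TDI_def Let_def
proof (intro allI impI)
  fix w :: "nat set \<Rightarrow> real" assume int: "\<forall>k\<in>M. w k \<in> \<int>"
  obtain X and u :: "ineq \<Rightarrow> int" where X: "X \<subseteq> M" "\<forall>c\<in>C. \<Union>c \<in> X \<longleftrightarrow> c \<subseteq> X" and u: "\<forall>i. 0 \<le> u i"
    "\<forall>k\<in>M. coef (\<lambda>i. real_of_int (u i)) k = real_of_int \<lfloor>w k\<rfloor>"
    "dual_value (\<lambda>i. real_of_int (u i)) = real_of_int (\<Sum>k\<in>X. \<lfloor>w k\<rfloor>)"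
    using forest_integral_dual[OF order_refl assms(2,1), of "\<lambda>k. \<lfloor>w k\<rfloor>"] by meson
  have w: "real_of_int \<lfloor>w k\<rfloor> = w k" if "k \<in> M" for k
    using int that by (auto elim!: Ints_cases)
  have opt_value: "dual_value (\<lambda>i. real_of_int (u i)) = (\<Sum>k\<in>M. w k * of_bool (k \<in> X))"
    unfolding u(3) of_int_sum using X(1) finite_M w by (intro sum.mono_neutral_cong_left) auto
  have "dual_value (\<lambda>i. real_of_int (u i)) \<le> dual_value u'"
    if u': "\<forall>i\<in>rows. 0 \<le> u' i" "\<forall>k\<in>M. (\<Sum>i\<in>rows. u' i * ineq_lhs i k) = w k" for u'
  proof -
    have "(\<Sum>k\<in>M. w k * of_bool (k \<in> X)) = (\<Sum>k\<in>M. coef u' k * of_bool (k \<in> X))"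
      using u'(2) by (intro sum.cong) (auto simp: coef_def)
    also have "\<dots> \<le> dual_value u'"
    proof (rule weak_duality)
      fix i assume i: "i \<in> rows"
      then have "row_constraint i \<subseteq> C" by (auto simp: ineq_index_def)
      then show "(\<Sum>k\<in>M. ineq_lhs i k * of_bool (k \<in> X)) \<le> ineq_rhs i"
        using i X(2) by (intro indicator_feasible) auto
    qed (use u'(1) in simp)
    finally show ?thesis using opt_value by simp
  qed
  moreover have "(\<lambda>i. real_of_int (u i)) \<in> {u. (\<forall>i\<in>rows. 0 \<le> u i) \<and> (\<forall>k\<in>M. (\<Sum>i\<in>rows. u i * ineq_lhs i k) = w k)}"
    using u(1,2) w by (simp add: coef_def)
  ultimately show "\<exists>u\<in>{u. (\<forall>i\<in>rows. 0 \<le> u i) \<and> (\<forall>k\<in>M. (\<Sum>i\<in>rows. u i * ineq_lhs i k) = w k)}.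
      (\<forall>i\<in>rows. u i \<in> \<int>) \<and>
      (\<forall>u'\<in>{u. (\<forall>i\<in>rows. 0 \<le> u i) \<and> (\<forall>k\<in>M. (\<Sum>i\<in>rows. u i * ineq_lhs i k) = w k)}.
        (\<Sum>i\<in>rows. ineq_rhs i * u i) \<le> (\<Sum>i\<in>rows. ineq_rhs i * u' i))"
    by (intro bexI[of _ "\<lambda>i. real_of_int (u i)"]) (simp_all add: dual_value_def)
qed

end

theorem theorem3p6:
  fixes n :: nat and M :: "nat set set" and C :: "nat set set set" and T :: "nat set set"
  assumes lin: "linearization n M C"
    and cons: "consistent n M C"
    and simp: "simple_lin n M C"
    and T: "T \<subseteq> proper_monos n M"
  shows "(integral_polytope (proj (singletons n \<union> T) (relaxation M C)) \<longleftrightarrow>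
          \<not> (\<exists>VZ AZ. subdigraph VZ AZ M (arcs_D C) \<and>
                     is_cycle_graph VZ (undirected AZ) \<and>
                     VZ \<subseteq> succ (arcs_D C) T))
       \<and> (integral_polytope (proj (singletons n \<union> T) (relaxation M C)) \<and>
           proper_monos n M \<subseteq> succ (arcs_D C) T
           \<longrightarrow> TDI (ineq_index M C) M ineq_lhs ineq_rhs)"
proof -
  interpret simple_linearization n M C
    using lin cons simp by unfold_locales
  have iff: "integral_polytope (proj (S \<union> T) (relaxation M C)) \<longleftrightarrow> acyclic_on (succ A T)"
    using acyclic_imp_integral[OF T] integral_imp_acyclic[OF T] by metis
  \<comment> \<open>All resultants are proper monomials, so here every star lies inside
    \<open>succ A T\<close> and acyclicity there covers the whole system.\<close>
  have "TDI rows M ineq_lhs ineq_rhs" if "acyclic_on (succ A T)" "P \<subseteq> succ A T"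
    using that(1)
  proof (rule acyclic_imp_TDI)
    show "star c \<subseteq> succ A T" if c: "c \<in> C" for c
      by (rule star_sub_succ[OF c subsetD[OF \<open>P \<subseteq> succ A T\<close> Union_P[OF c]]])
  qed
  then show ?thesis
    unfolding cycle_subdigraph_iff[OF arcs_sub] iff by metis
qed

end
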